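(* Let $L/K$ be a finite extension with maximal separable subextension $L_S/K$ and maximal purely inseparable subextension $L_I/K$, and let $A=\mathrm{Aut}(L/K)$ with fixed field $L^A$. The following are equivalent: (a) $L/K$ is normal; (b) $t_K(L)=[L:L_I]$; (c) $u_K(L)=1$ and $L=L_SL_I$; (d) $L^A=L_I$; (e) $L/L_I$ is Galois.
   Context: $K$ is any field (not necessarily perfect) with a fixed algebraic closure $\bar K$; all extensions are finite and contained in $\bar K$. With $F/K$ the largest Galois subextension of $L/K$ (so $F\subset L_S$), the ascending index is $t_K(L)=[F:K]$ and $u_K(L)=[L_S:F]$. *)

theory Defs
  imports "HOL-Algebra.Algebraic_Closure" "HOL-Algebra.Generated_Fields"
begin

text \<open>Throughout, \<open>\<Omega>\<close> stands for an algebraic closure of the ground field, and all fields are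
  subfields of \<open>\<Omega>\<close>, represented by their carriers.\<close>

definition subextension :: "('a, 'b) ring_scheme \<Rightarrow> 'a set \<Rightarrow> 'a set \<Rightarrow> 'a set \<Rightarrow> bool" where
  "subextension \<Omega> K L E \<longleftrightarrow> subfield E \<Omega> \<and> K \<subseteq> E \<and> E \<subseteq> L"

definition algebraic_ext :: "('a, 'b) ring_scheme \<Rightarrow> 'a set \<Rightarrow> 'a set \<Rightarrow> bool" where
  "algebraic_ext \<Omega> K L \<longleftrightarrow> (\<forall>x\<in>L. ring.algebraic \<Omega> K x)"

text \<open>The minimal polynomial has only simple roots; roots in \<open>\<Omega>\<close> are all the roots, as \<open>\<Omega>\<close> is
  algebraically closed.\<close>

definition separable_elem :: "('a, 'b) ring_scheme \<Rightarrow> 'a set \<Rightarrow> 'a \<Rightarrow> bool" where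
  "separable_elem \<Omega> K x \<longleftrightarrow> ring.algebraic \<Omega> K x \<and>
     (\<forall>a\<in>carrier \<Omega>. ring.alg_mult \<Omega> (ring.Irr \<Omega> K x) a \<le> 1)"

definition separable_ext :: "('a, 'b) ring_scheme \<Rightarrow> 'a set \<Rightarrow> 'a set \<Rightarrow> bool" where
  "separable_ext \<Omega> K L \<longleftrightarrow> (\<forall>x\<in>L. separable_elem \<Omega> K x)"

definition purely_insep_ext :: "('a, 'b) ring_scheme \<Rightarrow> 'a set \<Rightarrow> 'a set \<Rightarrow> bool" where
  "purely_insep_ext \<Omega> K L \<longleftrightarrow> algebraic_ext \<Omega> K L \<and> (\<forall>x\<in>L - K. \<not> separable_elem \<Omega> K x)"

text \<open>Splitting over \<open>L\<close> is expressed by applying \<open>splitted\<close> to \<open>L\<close> as a ring of its own. The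
  library's \<open>splitted_on L\<close> is not suitable: it intersects the multiset of roots with
  \<open>mset_set L\<close>, which drops multiplicities, and all roots if \<open>L\<close> is infinite.\<close>

definition normal_ext :: "('a, 'b) ring_scheme \<Rightarrow> 'a set \<Rightarrow> 'a set \<Rightarrow> bool" where
  "normal_ext \<Omega> K L \<longleftrightarrow> algebraic_ext \<Omega> K L \<and>
     (\<forall>p\<in>carrier (K[X]\<^bsub>\<Omega>\<^esub>). pirreducible\<^bsub>\<Omega>\<^esub> K p \<and> (\<exists>x\<in>L. ring.eval \<Omega> p x = \<zero>\<^bsub>\<Omega>\<^esub>) \<longrightarrow>
        ring.splitted (\<Omega>\<lparr>carrier := L\<rparr>) p)"

definition galois_ext :: "('a, 'b) ring_scheme \<Rightarrow> 'a set \<Rightarrow> 'a set \<Rightarrow> bool" where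
  "galois_ext \<Omega> K L \<longleftrightarrow> normal_ext \<Omega> K L \<and> separable_ext \<Omega> K L"

text \<open>\<open>Greatest\<close> is taken with respect to inclusion of carriers.\<close>

definition max_separable :: "('a, 'b) ring_scheme \<Rightarrow> 'a set \<Rightarrow> 'a set \<Rightarrow> 'a set" where
  "max_separable \<Omega> K L = (GREATEST E. subextension \<Omega> K L E \<and> separable_ext \<Omega> K E)"

definition max_purely_insep :: "('a, 'b) ring_scheme \<Rightarrow> 'a set \<Rightarrow> 'a set \<Rightarrow> 'a set" where
  "max_purely_insep \<Omega> K L = (GREATEST E. subextension \<Omega> K L E \<and> purely_insep_ext \<Omega> K E)"

definition max_galois :: "('a, 'b) ring_scheme \<Rightarrow> 'a set \<Rightarrow> 'a set \<Rightarrow> 'a set" where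
  "max_galois \<Omega> K L = (GREATEST E. subextension \<Omega> K L E \<and> galois_ext \<Omega> K E)"

definition ascending_index :: "('a, 'b) ring_scheme \<Rightarrow> 'a set \<Rightarrow> 'a set \<Rightarrow> nat" where
  "ascending_index \<Omega> K L = ring.dim \<Omega> K (max_galois \<Omega> K L)"

definition u_index :: "('a, 'b) ring_scheme \<Rightarrow> 'a set \<Rightarrow> 'a set \<Rightarrow> nat" where
  "u_index \<Omega> K L = ring.dim \<Omega> (max_galois \<Omega> K L) (max_separable \<Omega> K L)"

definition compositum :: "('a, 'b) ring_scheme \<Rightarrow> 'a set \<Rightarrow> 'a set \<Rightarrow> 'a set" where
  "compositum \<Omega> E F = generate_field \<Omega> (E \<union> F)"

text \<open>Extensionality picks one representative function for each automorphism of \<open>L\<close>.\<close>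

definition Aut_ext :: "('a, 'b) ring_scheme \<Rightarrow> 'a set \<Rightarrow> 'a set \<Rightarrow> ('a \<Rightarrow> 'a) set" where
  "Aut_ext \<Omega> K L = {\<sigma> \<in> ring_iso (\<Omega>\<lparr>carrier := L\<rparr>) (\<Omega>\<lparr>carrier := L\<rparr>) \<inter> extensional L.
     \<forall>x\<in>K. \<sigma> x = x}"

definition fixed_field :: "'a set \<Rightarrow> ('a \<Rightarrow> 'a) set \<Rightarrow> 'a set" where
  "fixed_field L A = {x \<in> L. \<forall>\<sigma>\<in>A. \<sigma> x = x}"

end

theory Submission
  imports Defs "HOL-Computational_Algebra.Primes"
begin

text \<open>
  Let \<open>G\<close> be the monoid of \<open>K\<close>-endomorphisms of \<open>\<Omega>\<close>. By Zorn's lemma the conjugates of an element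
  over \<open>K\<close> are exactly its \<open>G\<close>-orbit, so \<open>L/K\<close> is normal iff \<open>G L \<subseteq> L\<close>. In characteristic \<open>p\<close>,
  an inseparable \<open>x\<close> satisfies \<open>deg x^p < deg x\<close>, and \<open>x\<close> is fixed by every endomorphism that
  fixes \<open>x^p\<close>; hence \<open>L\<^sub>I\<close> is the set of elements of \<open>L\<close> fixed by \<open>G\<close>. Separable and purely
  inseparable extensions are linearly disjoint, because \<open>G\<close> does not see the latter; this yields that
  the separable elements form a field and that \<open>[F L\<^sub>I : L\<^sub>I] = [F : K]\<close>, so (b) and (c) both force
  \<open>L\<close> to be generated by \<open>F\<close> and \<open>L\<^sub>I\<close>, which are \<open>G\<close>-stable. Finally, if \<open>L\<^sup>A = L\<^sub>I\<close>, the polynomial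
  with simple roots \<open>A x\<close> has coefficients in \<open>L\<^sub>I\<close>, so \<open>L/L\<^sub>I\<close> is Galois.
\<close>

subsection \<open>Formal derivatives\<close>

text \<open>All five conditions are compared with one property, the stability of \<open>L\<close>
  under the endomorphisms of \<Omega> over \<open>K\<close>. It sees no difference between
  \<open>K\<close> and \<open>L\<^sub>I\<close>, since every such endomorphism fixes
  \<open>L\<^sub>I\<close>; so (e) is (a) together with separability of \<open>L\<close> over
  \<open>L\<^sub>I\<close>, which is obtained by way of (d). If \<open>L\<close> is stable and
  \<open>M\<close> contains \<open>L\<^sub>S\<close> and \<open>L\<^sub>I\<close>, then
  \<open>L\<close> is separable over \<open>M\<close> because of \<open>L\<^sub>I\<close>, and its
  elements are fixed by all endomorphisms over \<open>M\<close> because of \<open>L\<^sub>S\<close>;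
  together these force \<open>L\<close> into \<open>M\<close>. The obstacle is that a greatest
  subextension is worth nothing until the evident candidate set is known to be a field. For fixed or
  stable elements this is immediate; for separable ones it takes a degree argument, in which
  separability is used by counting: the orbit has as many elements as the minimal polynomial has
  degree. Derivatives serve only to show that the degree drops from x to its p-th power.\<close>

fun (in ring) pderiv :: "'a list \<Rightarrow> 'a list" where
  "pderiv [] = []"
| "pderiv (a # p) = (if p = [] then [] else add_pow R (length p) a # pderiv p)"

context ring begin

lemma length_pderiv: "length (pderiv p) = length p - 1"
  by (induct p) auto

lemma set_pderiv:
  assumes "subring K R" and "set p \<subseteq> K" shows "set (pderiv p) \<subseteq> K"
proof -
  have pow: "add_pow R n a \<in> K" if "a \<in> K" for n :: nat and a
    using that by (induct n) (auto simp: subringE[OF assms(1)])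
  show ?thesis using assms(2) by (induct p) (auto simp: pow)
qed

lemma pderiv_in_carrier: "set p \<subseteq> carrier R \<Longrightarrow> set (pderiv p) \<subseteq> carrier R"
  using set_pderiv[OF carrier_is_subring] .

text \<open>In \<open>u @ a # v\<close> the entry \<open>a\<close> is the coefficient of degree
  \<open>length v\<close>, and the derivative carries it multiplied by that degree. For the constant
  term the claim is the trivial multiple 0.\<close>

lemma pderiv_zero_imp_add_pow:
  assumes "set (pderiv (u @ a # v)) \<subseteq> {\<zero>}" shows "add_pow R (length v) a = \<zero>"
  using assms by (induct u) (auto split: if_splits)

end

context domain begin

text \<open>\<open>pderiv\<close> acts on raw coefficient lists, leading coefficient first, and may
  produce leading zeros in positive characteristic. Derivatives are therefore compared by their
  values, which padding does not change.\<close>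

lemma eval_pderiv_normalize:
  assumes "set p \<subseteq> carrier R" "x \<in> carrier R"
  shows "eval (pderiv (normalize p)) x = eval (pderiv p) x"
  using assms
proof (induct p)
  case (Cons a p)
  show ?case
  proof (cases "a = \<zero> \<and> p \<noteq> []")
    case True
    have "eval (pderiv (a # p)) x = eval (pderiv p) x"
      using True Cons(2-3) eval_in_carrier[OF pderiv_in_carrier, of p x] by simp
    then show ?thesis using True Cons by simp
  qed (use Cons in auto)
qed simp

lemma eval_pderiv_Cons:
  assumes "p \<noteq> []"
  shows "eval (pderiv (a # p)) x = add_pow R (length p) a \<otimes> x [^] (length p - 1) \<oplus> eval (pderiv p) x"
  using assms by (simp add: length_pderiv)

lemma eval_pderiv_map2:
  assumes "length p = length q" "set p \<subseteq> carrier R" "set q \<subseteq> carrier R" "x \<in> carrier R"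
  shows "eval (pderiv (map2 (\<oplus>) p q)) x = eval (pderiv p) x \<oplus> eval (pderiv q) x"
  using assms
proof (induct p q rule: list_induct2)
  case (Cons a p b q)
  show ?case
  proof (cases "p = []")
    case False
    with Cons(1) have q: "q \<noteq> []" and m: "map2 (\<oplus>) p q \<noteq> []" by (auto simp: zip_eq_Nil_iff)
    have 1: "eval (pderiv p) x \<in> carrier R" "eval (pderiv q) x \<in> carrier R"
      using Cons by (auto intro!: eval_in_carrier pderiv_in_carrier)
    have 2: "add_pow R (length q) (a \<oplus> b) = add_pow R (length q) a \<oplus> add_pow R (length q) b"
      using Cons by (simp add: add.nat_pow_distrib)
    show ?thesis
      using Cons 1 q m False eval_pderiv_Cons[OF False] eval_pderiv_Cons[OF q] eval_pderiv_Cons[OF m]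
      by (simp del: eval.simps pderiv.simps add: 2 l_distr a_ac)
  qed (use Cons in auto)
qed simp

text \<open>Appending \<zero> is multiplication by X, so this is the product rule for X times
  \<open>p\<close>. Multiplication by X + c is this shift plus a scalar multiple.\<close>

lemma eval_pderiv_snoc_zero:
  assumes "set p \<subseteq> carrier R" "x \<in> carrier R"
  shows "eval (pderiv (p @ [\<zero>])) x = x \<otimes> eval (pderiv p) x \<oplus> eval p x"
  using assms
proof (induct p)
  case (Cons a p)
  have c: "eval (pderiv p) x \<in> carrier R" "eval p x \<in> carrier R"
    using Cons by (auto intro!: eval_in_carrier pderiv_in_carrier)
  show ?case
  proof (cases "p = []")
    case False
    obtain n where n: "length p = Suc n" using False by (cases p) auto
    have "x \<otimes> (add_pow R (Suc n) a \<otimes> x [^] n) = add_pow R (Suc n) a \<otimes> x [^] Suc n"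
      using Cons by (simp add: m_ac)
    moreover have "add_pow R (Suc (Suc n)) a = a \<oplus> add_pow R (Suc n) a"
      using Cons by (simp add: a_ac)
    ultimately show ?thesis
      using Cons c n eval_pderiv_Cons[OF False] eval_pderiv_Cons[of "p @ [\<zero>]"]
      by (simp del: pderiv.simps add.nat_pow_Suc nat_pow_Suc add: l_distr r_distr a_ac)
  qed (use Cons in auto)
qed simp

lemma eval_pderiv_smult:
  assumes "set p \<subseteq> carrier R" "x \<in> carrier R" "c \<in> carrier R"
  shows "eval (pderiv (map ((\<otimes>) c) p)) x = c \<otimes> eval (pderiv p) x"
  using assms
proof (induct p)
  case (Cons a p)
  have c: "eval (pderiv p) x \<in> carrier R"
    using Cons by (auto intro!: eval_in_carrier pderiv_in_carrier)
  have "add_pow R (length p) (c \<otimes> a) \<otimes> y = c \<otimes> (add_pow R (length p) a \<otimes> y)"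
    if "y \<in> carrier R" for y
    using Cons that by (simp add: add_pow_rdistr[symmetric] m_assoc)
  then show ?case
    using Cons c by (simp add: length_pderiv r_distr)
qed simp

lemma eval_pderiv_mult_linear:
  assumes "set q \<subseteq> carrier R" "x \<in> carrier R" "c \<in> carrier R"
  shows "eval (pderiv (poly_mult [\<one>, c] q)) x = (x \<oplus> c) \<otimes> eval (pderiv q) x \<oplus> eval q x"
proof -
  let ?D = "\<lambda>p. eval (pderiv p) x"
  define m where "m = map ((\<otimes>) c) q"
  \<comment> \<open>\<open>r\<close> is \<open>c\<close> times \<open>q\<close>, padded with zeros
    to the length of the shifted \<open>q\<close>, as the addition of coefficient lists does with
    its shorter summand.\<close>
  define r where "r = replicate (Suc (length q) - length (normalize m)) \<zero> @ normalize m"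
  have m: "set m \<subseteq> carrier R" using assms unfolding m_def by auto
  have "length (normalize m) \<le> Suc (length q)"
    using normalize_length_le[of m] unfolding m_def by simp
  then have len: "length r = length (q @ [\<zero>])" unfolding r_def by simp
  have r: "set r \<subseteq> carrier R"
    using normalize_in_carrier[OF m] unfolding r_def by (auto simp: set_replicate_conv_if)
  have Dr: "?D r = ?D m"
    using eval_pderiv_normalize[OF r assms(2)] eval_pderiv_normalize[OF m assms(2)]
      eval_pderiv_normalize[OF normalize_in_carrier[OF m] assms(2)]
    unfolding r_def normalize_replicate_zero by simp
  have cr: "?D q \<in> carrier R" "eval q x \<in> carrier R"
    using assms by (auto intro!: eval_in_carrier pderiv_in_carrier)
  have "map ((\<otimes>) \<one>) q = q" using assms(1) by (induct q) auto
  then have "poly_mult [\<one>, c] q = normalize (map2 (\<oplus>) (q @ [\<zero>]) r)"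
    using poly_mult_const'(1)[OF assms(1,3)] len unfolding r_def m_def[symmetric] by simp
  moreover have "set (map2 (\<oplus>) (q @ [\<zero>]) r) \<subseteq> carrier R"
  proof -
    have "a \<oplus> b \<in> carrier R" if "(a, b) \<in> set (zip (q @ [\<zero>]) r)" for a b
      using set_zip_leftD[OF that] set_zip_rightD[OF that] assms(1) r by auto
    then show ?thesis by auto
  qed
  ultimately have "?D (poly_mult [\<one>, c] q) = ?D (map2 (\<oplus>) (q @ [\<zero>]) r)"
    using eval_pderiv_normalize[OF _ assms(2)] by metis
  also have "\<dots> = ?D (q @ [\<zero>]) \<oplus> ?D r"
    using assms r len by (intro eval_pderiv_map2) auto
  also have "\<dots> = (x \<otimes> ?D q \<oplus> eval q x) \<oplus> c \<otimes> ?D q"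
    using Dr eval_pderiv_snoc_zero[OF assms(1,2)] eval_pderiv_smult[OF assms] unfolding m_def by simp
  finally show ?thesis using assms cr by (simp add: l_distr a_ac)
qed

lemma eval_mult_root_factor:
  assumes "set q \<subseteq> carrier R" "x \<in> carrier R"
  shows "eval (poly_mult [\<one>, \<ominus> x] q) x = \<zero>"
proof -
  have "eval [\<one>, \<ominus> x] x = \<zero>" using assms(2) by (simp add: r_neg)
  then show ?thesis
    using eval_poly_mult[of "[\<one>, \<ominus> x]" q x] eval_in_carrier[OF assms] assms
    by (simp del: poly_mult.simps eval.simps)
qed

lemma eval_pderiv_mult_root_factor:
  assumes "set q \<subseteq> carrier R" "x \<in> carrier R"
  shows "eval (pderiv (poly_mult [\<one>, \<ominus> x] q)) x = eval q x"
  using eval_pderiv_mult_linear[OF assms a_inv_closed[OF assms(2)]] assms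
    eval_in_carrier[OF pderiv_in_carrier[OF assms(1)] assms(2)] eval_in_carrier[OF assms]
  by (simp del: poly_mult.simps eval.simps add: r_neg)

text \<open>Write \<open>p\<close> as (X - x)(X - x)r. The product rule for one linear factor,
  evaluated at x, leaves the value of (X - x)r, which is zero.\<close>

lemma multiple_root_imp_pderiv_root:
  assumes "p \<in> carrier (poly_ring R)" "alg_mult p x > 1"
  shows "eval (pderiv p) x = \<zero>"
proof -
  interpret UP: domain "poly_ring R" using univ_poly_is_domain[OF carrier_is_subring] .
  \<comment> \<open>By convention \<open>alg_mult\<close> is 0 outside the carrier.\<close>
  have x: "x \<in> carrier R" using assms(2) unfolding alg_mult_def by (auto split: if_splits)
  define l where "l = [\<one>, \<ominus> x]"
  have l: "l \<in> carrier (poly_ring R)"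
    using x unfolding l_def univ_poly_carrier[symmetric] polynomial_def by auto
  have "l [^]\<^bsub>poly_ring R\<^esub> (2::nat) pdivides p"
    using le_alg_mult_imp_pdivides[OF x assms(1), of 2] assms(2) unfolding l_def by simp
  moreover have "l [^]\<^bsub>poly_ring R\<^esub> (2::nat) = l \<otimes>\<^bsub>poly_ring R\<^esub> l"
    using l by (simp add: numeral_2_eq_2)
  ultimately obtain r where r: "r \<in> carrier (poly_ring R)"
    and p: "p = (l \<otimes>\<^bsub>poly_ring R\<^esub> l) \<otimes>\<^bsub>poly_ring R\<^esub> r"
    unfolding pdivides_def factor_def by auto
  have set: "set s \<subseteq> carrier R" if "s \<in> carrier (poly_ring R)" for s
    using that unfolding univ_poly_carrier[symmetric] polynomial_def by auto
  have "p = poly_mult l (poly_mult l r)"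
    using p UP.m_assoc[OF l l r] by (simp add: univ_poly_mult del: poly_mult.simps)
  moreover have "set (poly_mult l r) \<subseteq> carrier R"
    using set[OF UP.m_closed[OF l r]] unfolding univ_poly_mult .
  ultimately show ?thesis
    using eval_pderiv_mult_root_factor[OF _ x, folded l_def]
      eval_mult_root_factor[OF set[OF r] x, folded l_def]
    by (simp del: poly_mult.simps)
qed

end

subsection \<open>Binomial theorem and Frobenius\<close>

theorem (in cring) binomial:
  assumes "x \<in> carrier R" "y \<in> carrier R"
  shows "(x \<oplus> y) [^] (n::nat) =
    (\<Oplus>k\<in>{..n}. add_pow R (n choose k) (x [^] k \<otimes> y [^] (n - k)))"
proof (induct n)
  case (Suc n)
  let ?t = "\<lambda>n c k. add_pow R (c :: nat) (x [^] (k::nat) \<otimes> y [^] (n - k :: nat))"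
  have t: "?t n c k \<in> carrier R" for n c k using assms by simp
  have xt: "x \<otimes> ?t n c k = ?t (Suc n) c (Suc k)" for c k
    using assms by (simp add: add_pow_rdistr m_ac)
  have yt: "y \<otimes> ?t n c k = ?t (Suc n) c k" if "k \<le> n" for c k
    using assms that by (simp add: add_pow_rdistr Suc_diff_le m_ac)
  \<comment> \<open>The sum is extended by the vanishing term for \<open>n choose Suc n\<close>,
    then its term at 0 is split off. What remains is indexed by \<open>Suc k\<close>, like the sum
    multiplied by \<open>x\<close>, and Pascal's rule applies termwise.\<close>
  have y: "(\<Oplus>k\<in>{..n}. y \<otimes> ?t n (n choose k) k)
      = (\<Oplus>k\<in>{..n}. ?t (Suc n) (n choose Suc k) (Suc k)) \<oplus> ?t (Suc n) 1 0"
  proof -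
    have "(\<Oplus>k\<in>{..n}. y \<otimes> ?t n (n choose k) k) = (\<Oplus>k\<in>{..n}. ?t (Suc n) (n choose k) k)"
      using yt t by (intro add.finprod_cong') auto
    also have "\<dots> = (\<Oplus>k\<in>{..Suc n}. ?t (Suc n) (n choose k) k)"
      using t assms by (simp add: binomial_eq_0)
    also have "\<dots> = (\<Oplus>k\<in>{..n}. ?t (Suc n) (n choose Suc k) (Suc k)) \<oplus> ?t (Suc n) 1 0"
      by (subst finsum_Suc2) (use t in auto)
    finally show ?thesis .
  qed
  have "(x \<oplus> y) [^] Suc n = x \<otimes> (\<Oplus>k\<in>{..n}. ?t n (n choose k) k) \<oplus> y \<otimes> (\<Oplus>k\<in>{..n}. ?t n (n choose k) k)"
    using Suc t assms by (simp add: m_comm l_distr)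
  also have "\<dots> = (\<Oplus>k\<in>{..n}. ?t (Suc n) (n choose k) (Suc k)) \<oplus>
      ((\<Oplus>k\<in>{..n}. ?t (Suc n) (n choose Suc k) (Suc k)) \<oplus> ?t (Suc n) 1 0)"
    using assms t y by (simp add: finsum_rdistr xt[simplified])
  also have "\<dots> = (\<Oplus>k\<in>{..n}. ?t (Suc n) (n choose k) (Suc k) \<oplus> ?t (Suc n) (n choose Suc k) (Suc k))
      \<oplus> ?t (Suc n) 1 0"
    using assms by (subst finsum_addf) (auto intro!: a_assoc[symmetric] finsum_closed)
  also have "\<dots> = (\<Oplus>k\<in>{..n}. ?t (Suc n) (Suc n choose Suc k) (Suc k)) \<oplus> ?t (Suc n) (Suc n choose 0) 0"
    using assms by (simp add: add.nat_pow_mult)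
  also have "\<dots> = (\<Oplus>k\<in>{..Suc n}. ?t (Suc n) (Suc n choose k) k)"
    by (subst finsum_Suc2) (use t in auto)
  finally show ?case .
qed (use assms in simp)

context domain begin

text \<open>If \<open>p\<close> did not divide \<open>n\<close>, a Bezout relation u n = v p + 1
  would write \<open>a\<close> as a difference of multiples of \<open>n a\<close> and
  \<open>p a\<close>, both zero.\<close>

lemma add_pow_eq_zero_imp_dvd:
  assumes "prime (p::nat)" "add_pow R p \<one> = \<zero>" "a \<in> carrier R" "a \<noteq> \<zero>" "add_pow R n a = \<zero>"
  shows "p dvd n"
proof (rule ccontr)
  assume "\<not> p dvd n"
  then have "coprime p n" using assms(1) prime_imp_coprime by blast
  then obtain u v where uv: "u * n = v * p + 1"
    using coprime_bezout_strong[of n p] assms(1) by (metis coprime_commute mult.commute not_prime_1)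
  have "add_pow R p a = add_pow R p \<one> \<otimes> a"
    using assms(3) by (simp add: add_pow_ldistr)
  then have pa: "add_pow R p a = \<zero>" using assms by simp
  have "add_pow R (n * u) a = \<zero>" "add_pow R (p * v) a = \<zero>"
    using assms(3,5) pa by (simp_all add: add.nat_pow_pow[symmetric])
  moreover have "add_pow R (u * n) a = add_pow R (v * p) a \<oplus> a"
    using assms(3) unfolding uv by simp
  ultimately show False using assms(3,4) by (simp add: mult.commute)
qed

text \<open>Split a prime p off n = p m: in a domain either p or m already annihilates \<one>, and m
  is smaller.\<close>

lemma add_pow_eq_zero_imp_prime:
  assumes "n > 0" "add_pow R (n::nat) \<one> = \<zero>"
  obtains p :: nat where "prime p" "add_pow R p \<one> = \<zero>"
proof -
  have "\<exists>p::nat. prime p \<and> add_pow R p \<one> = \<zero>" using assms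
  proof (induct n rule: less_induct)
    case (less n)
    have "n \<noteq> 1" using less(3) by auto
    then obtain p where p: "prime p" "p dvd n" using prime_factor_nat by blast
    then obtain m where m: "n = p * m" by auto
    have "add_pow R p \<one> \<otimes> add_pow R m \<one> = add_pow R (p * m) \<one>"
      by (simp add: add_pow_ldistr add.nat_pow_pow mult.commute)
    then have "add_pow R p \<one> = \<zero> \<or> add_pow R m \<one> = \<zero>"
      using less(3) m by (simp add: integral_iff)
    moreover have "m < n" "m > 0" using p m less(2) prime_gt_1_nat[OF p(1)] by auto
    ultimately show ?case using less(1) p(1) by blast
  qed
  then show thesis using that by blast
qed

lemma frobenius_add:
  assumes "prime (p::nat)" "add_pow R p \<one> = \<zero>" "x \<in> carrier R" "y \<in> carrier R"
  shows "(x \<oplus> y) [^] p = x [^] p \<oplus> y [^] p"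
proof -
  obtain n where n: "p = Suc (Suc n)"
    using prime_ge_2_nat[OF assms(1)] by (metis add_2_eq_Suc le_Suc_ex)
  let ?t = "\<lambda>k. add_pow R (p choose k) (x [^] k \<otimes> y [^] (p - k))"
  have t: "?t k \<in> carrier R" for k using assms by simp
  \<comment> \<open>With \<open>p = Suc (Suc n)\<close>, the indices \<open>Suc k\<close> for
    \<open>k \<le> n\<close> are exactly 1 to p - 1, where p divides the binomial
    coefficient.\<close>
  have z: "?t (Suc k) = \<zero>" if "k \<in> {..n}" for k
  proof -
    have "p dvd (p choose Suc k)"
      using that n by (intro dvd_choose_prime assms) auto
    then obtain m where m: "p choose Suc k = p * m" by auto
    have "add_pow R p (x [^] Suc k \<otimes> y [^] (p - Suc k))
        = add_pow R p \<one> \<otimes> (x [^] Suc k \<otimes> y [^] (p - Suc k))"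
      using assms(3,4) by (simp add: add_pow_ldistr)
    then have "add_pow R p (x [^] Suc k \<otimes> y [^] (p - Suc k)) = \<zero>"
      using assms by simp
    then show ?thesis
      using assms(3,4) unfolding m by (simp add: add.nat_pow_pow[symmetric])
  qed
  have "(x \<oplus> y) [^] p = (\<Oplus>k\<in>{..Suc (Suc n)}. ?t k)"
    using binomial[OF assms(3,4), of p] n by simp
  also have "\<dots> = ?t p \<oplus> ((\<Oplus>k\<in>{..n}. ?t (Suc k)) \<oplus> ?t 0)"
    using finsum_Suc[of ?t "Suc n"] finsum_Suc2[of ?t n] t unfolding Pi_def n by (simp only: mem_Collect_eq simp_thms if_cancel refl)
  also have "(\<Oplus>k\<in>{..n}. ?t (Suc k)) = \<zero>"
    using z by (intro add.finprod_one_eqI) auto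
  finally show ?thesis using assms(3,4) by simp
qed

text \<open>The Frobenius map sends x - y to zero. Expanding x as y + (x - y) needs additivity alone
  and avoids the sign of (-1)^p.\<close>

lemma frobenius_inj:
  assumes "prime (p::nat)" "add_pow R p \<one> = \<zero>" "x \<in> carrier R" "y \<in> carrier R"
    and "x [^] p = y [^] p"
  shows "x = y"
proof -
  have "(y \<oplus> (x \<ominus> y)) [^] p = y [^] p \<oplus> (x \<ominus> y) [^] p"
    using assms by (intro frobenius_add) auto
  moreover have "y \<oplus> (x \<ominus> y) = x" using assms(3,4) by algebra
  ultimately have "x [^] p = x [^] p \<oplus> (x \<ominus> y) [^] p" using assms(5) by simp
  then have "(x \<ominus> y) [^] p = \<zero>" using assms(3,4) by (simp add: add.l_cancel_one')
  moreover have "z = \<zero>" if "z [^] n = \<zero>" "z \<in> carrier R" for z and n :: nat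
    using that by (induct n) (auto simp: integral_iff)
  ultimately have "x \<ominus> y = \<zero>" using assms(3,4) by blast
  then show ?thesis using assms(3,4) by (simp add: r_right_minus_eq)
qed

end

subsection \<open>Inseparable elements\<close>

text \<open>If only exponents divisible by \<open>p\<close> occur in f, then f(X) = g(X^p). For
  nonempty \<open>g\<close> the length bound says that \<open>p\<close> times the degree of
  \<open>g\<close> is at most the degree of \<open>f\<close>. The suffixes met in the induction may
  start with zeros, so the claim on the head is conditional.\<close>

lemma (in ring) eval_compress:
  assumes "p > 0" "set f \<subseteq> carrier R" "x \<in> carrier R"
    and "\<And>u a v. f = u @ a # v \<Longrightarrow> a \<noteq> \<zero> \<Longrightarrow> p dvd length v"
  shows "\<exists>g. set g \<subseteq> insert \<zero> (set f) \<and> length g * p < length f + p \<and>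
    (f \<noteq> [] \<longrightarrow> hd f \<noteq> \<zero> \<longrightarrow> g \<noteq> [] \<and> hd g = hd f) \<and> eval g (x [^] (p::nat)) = eval f x"
  using assms(2,4)
proof (induct f)
  case Nil
  then show ?case using assms(1) by (intro exI[of _ "[]"]) simp
next
  case (Cons a f)
  have "\<exists>g. set g \<subseteq> insert \<zero> (set f) \<and> length g * p < length f + p \<and>
    (f \<noteq> [] \<longrightarrow> hd f \<noteq> \<zero> \<longrightarrow> g \<noteq> [] \<and> hd g = hd f) \<and> eval g (x [^] p) = eval f x"
    using Cons(2) by (intro Cons(1)) (auto intro: Cons(3)[of "a # _"])
  then obtain g where g: "set g \<subseteq> insert \<zero> (set f)" "length g * p < length f + p"
    "eval g (x [^] p) = eval f x" by blast
  have cr: "eval f x \<in> carrier R" "set g \<subseteq> carrier R"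
    using Cons(2) g(1) assms(3) by (auto intro!: eval_in_carrier)
  show ?case
  proof (cases "a = \<zero>")
    case True
    then show ?thesis using g cr assms(3) by (intro exI[of _ g]) auto
  next
    case False
    then obtain m where m: "length f = p * m" using Cons(3)[of "[]" a f] by auto
    have "length g * p < (m + 1) * p" using g(2) m by (simp add: algebra_simps)
    then have le: "length g \<le> m" by (metis Suc_eq_plus1 less_Suc_eq_le mult_less_cancel2)
    \<comment> \<open>In \<open>a # f\<close> the entry \<open>a\<close> has degree
      \<open>p * m\<close>, so it must get degree \<open>m\<close> in the new list; zeros fill the
      gap down to \<open>g\<close>.\<close>
    let ?h = "a # replicate (m - length g) \<zero> @ g"
    have "eval ?h (x [^] p) = a \<otimes> (x [^] p) [^] m \<oplus> eval g (x [^] p)"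
      using le eval_replicate[OF cr(2), of "x [^] p" "m - length g"] assms(3) by simp
    also have "\<dots> = eval (a # f) x"
      using g(3) m assms(3) by (simp add: nat_pow_pow)
    finally show ?thesis
      using g(1) le m assms(1) by (intro exI[of _ ?h]) (auto simp: algebra_simps)
  qed
qed

lemma (in domain) Irr_eqI:
  assumes "subfield K R" "x \<in> carrier R" "p \<in> carrier (K[X])" "pirreducible K p" "eval p x = \<zero>"
    "lead_coeff p = \<one>"
  shows "algebraic K x" "Irr K x = p"
proof -
  show "algebraic K x"
    using algebraicI[OF assms(3) pirreducibleE(1)[OF subfieldE(1)[OF assms(1)] assms(3,4)] assms(5)]
    unfolding over_def .
  then show "Irr K x = p"
    using minimal_polynomial_is_unique[OF assms(1,2)] assms(3-6) IrrE[OF assms(1,2)]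
    unfolding over_def by metis
qed

text \<open>A multiple root makes the minimal polynomial f share a root with its derivative, which
  has smaller degree and so must vanish. Hence f(X) = g(X^p), and g annihilates x^p.\<close>

lemma (in field) inseparable_imp_degree_Irr_pow_less:
  assumes K: "subfield K R" and x: "x \<in> carrier R" "algebraic K x"
    and "\<not> separable_elem R K x"
  obtains p :: nat where "prime p" "add_pow R p \<one> = \<zero>" "degree (Irr K (x [^] p)) < degree (Irr K x)"
proof -
  let ?f = "Irr K x"
  note Irr = IrrE[OF K x(1), unfolded over_def, OF x(2)]
  have f: "?f \<in> carrier (poly_ring R)" "set ?f \<subseteq> K" "?f \<noteq> []"
    using Irr(1) carrier_polynomial_shell[OF subfieldE(1)[OF K]] pirreducibleE(1)[OF subfieldE(1)[OF K] Irr(1,2)]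
    unfolding univ_poly_carrier[symmetric] polynomial_def by auto
  have deg: "degree ?f \<ge> 1" using pirreducible_degree[OF K Irr(1,2)] .
  obtain a where "alg_mult ?f a > 1"
    using assms(4) x(2) unfolding separable_elem_def by (meson not_le)
  then have a: "eval (pderiv ?f) a = \<zero>" "a \<in> carrier R" "eval ?f a = \<zero>"
    using multiple_root_imp_pderiv_root[OF f(1)] alg_mult_gt_zero_iff_is_root[OF f(1), of a]
    unfolding is_root_def by auto
  \<comment> \<open>The multiple root \<open>a\<close> may differ from \<open>x\<close>, but
    \<open>?f\<close> is its minimal polynomial too and therefore divides every polynomial over
    \<open>K\<close> vanishing at \<open>a\<close>.\<close>
  note Irr_a = Irr_eqI[OF K a(2) Irr(1,2) a(3) Irr(3)]
  define g where "g = normalize (pderiv ?f)"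
  have dK: "set (pderiv ?f) \<subseteq> K" using set_pderiv[OF subfieldE(1)[OF K] f(2)] .
  have dR: "set (pderiv ?f) \<subseteq> carrier R" using dK subfieldE(3)[OF K] by auto
  have "g = []"
  proof (rule ccontr)
    assume "g \<noteq> []"
    moreover have "g \<in> carrier (K[X])"
      using normalize_gives_polynomial[OF dK] unfolding g_def univ_poly_carrier .
    moreover from this have "?f pdivides g"
      using Irr_minimal[OF K a(2), unfolded over_def, OF Irr_a(1), of g] a(1) eval_normalize[OF dR a(2)]
      unfolding g_def Irr_a(2) by simp
    ultimately have "degree ?f \<le> degree g"
      using pdivides_imp_degree_le[OF subfieldE(1)[OF K] Irr(1)] by blast
    then show False
      using normalize_length_le[of "pderiv ?f"] deg \<open>g \<noteq> []\<close> unfolding g_def length_pderiv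
      by (cases "normalize (pderiv ?f)") auto
  qed
  then have "set (pderiv ?f) \<subseteq> {\<zero>}"
    using normalize_trick[of "pderiv ?f"] unfolding g_def by (metis append_Nil2 set_replicate_conv_if empty_subsetI order_refl)
  then have null: "add_pow R (length v) a = \<zero>" if "?f = u @ a # v" for u a v
    using pderiv_zero_imp_add_pow that by metis
  \<comment> \<open>\<open>f'\<close> is the tail of the coefficient list, not the derivative. The
    leading coefficient \<one> is annihilated by the degree of \<open>?f\<close>, which shows that
    the characteristic is positive.\<close>
  obtain f' where f': "?f = \<one> # f'" using f(3) Irr(3) by (cases ?f) auto
  have "add_pow R (degree ?f) \<one> = \<zero>" using null[of "[]" \<one> f'] f' by simp
  then obtain p :: nat where p: "prime p" "add_pow R p \<one> = \<zero>"
    using add_pow_eq_zero_imp_prime deg by (metis less_le_trans zero_less_one)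
  have "p dvd length v" if "?f = u @ a # v" "a \<noteq> \<zero>" for u a v
  proof -
    have "a \<in> carrier R" using that(1) f(2) subfieldE(3)[OF K] by auto
    then show ?thesis using add_pow_eq_zero_imp_dvd[OF p _ that(2) null[OF that(1)]] by simp
  qed
  then obtain g where g: "set g \<subseteq> insert \<zero> (set ?f)" "length g * p < length ?f + p"
    "g \<noteq> []" "hd g = \<one>" "eval g (x [^] p) = \<zero>"
    using eval_compress[OF prime_gt_0_nat[OF p(1)] subset_trans[OF f(2) subfieldE(3)[OF K]] x(1)]
      f(3) Irr(3,4) one_not_zero by metis
  have gK: "g \<in> carrier (K[X])"
    using g(1,4) f(2) subringE(2)[OF subfieldE(1)[OF K]]
    unfolding univ_poly_carrier[symmetric] polynomial_def by auto
  have "algebraic K (x [^] p)" using algebraicI[OF gK g(3,5)] unfolding over_def .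
  then have "Irr K (x [^] p) pdivides g"
    using Irr_minimal[OF K _ _ gK g(5)] x(1) unfolding over_def by simp
  moreover have "Irr K (x [^] p) \<in> carrier (K[X])"
    using IrrE(1)[OF K] x(1) \<open>algebraic K (x [^] p)\<close> unfolding over_def by simp
  ultimately have "degree (Irr K (x [^] p)) \<le> degree g"
    using pdivides_imp_degree_le[OF subfieldE(1)[OF K] _ gK g(3)] by blast
  also have "\<dots> < degree ?f"
  proof -
    \<comment> \<open>\<open>n\<close> is the degree of \<open>g\<close>. From n p at most the
      degree of \<open>?f\<close>, p at least 2 and that degree at least 1, the strict inequality
      follows.\<close>
    obtain n where n: "length g = Suc n" using g(3) by (cases g) auto
    have "n * p < length ?f" using g(2) n by simp
    moreover have "2 * n \<le> n * p" using prime_ge_2_nat[OF p(1)] by simp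
    ultimately have "n < degree ?f" using deg by linarith
    then show ?thesis using n by simp
  qed
  finally show thesis using that p by blast
qed

subsection \<open>Endomorphisms of the algebraic closure\<close>

locale field_closure = algebraic_closure \<Omega> K for \<Omega> (structure) and K
begin

definition intermediate :: "'a set \<Rightarrow> bool" where
  "intermediate E \<longleftrightarrow> subfield E \<Omega> \<and> K \<subseteq> E"

text \<open>Surjectivity is not demanded: orbits and fixed points are what counts, and where a
  bijection of \<open>L\<close> is required it is recovered from the finiteness of sets of
  conjugates.\<close>

definition endos :: "'a set \<Rightarrow> ('a \<Rightarrow> 'a) set" where
  "endos E = {\<tau> \<in> ring_hom \<Omega> \<Omega>. \<forall>x\<in>E. \<tau> x = x}"

lemma intermediateD:
  assumes "intermediate E"
  shows "subfield E \<Omega>" "subring E \<Omega>" "E \<subseteq> carrier \<Omega>" "K \<subseteq> E"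
  using assms subfieldE(1,3) unfolding intermediate_def by auto

lemma intermediate_ground: "intermediate K"
  using subfield_axioms unfolding intermediate_def by auto

lemma intermediate_algebraic:
  assumes "intermediate E" "x \<in> carrier \<Omega>"
  shows "algebraic E x"
  using algebraic_mono[OF intermediateD(4)[OF assms(1)]] algebraic_extension[OF assms(2)]
  unfolding over_def by blast

text \<open>Since \<Omega> is algebraic over \<open>K\<close>, the inverse of x already lies in the
  ring generated by \<open>K\<close> and x. Field properties below thus reduce to subring
  properties.\<close>

lemma intermediateI:
  assumes "subring E \<Omega>" "K \<subseteq> E" shows "intermediate E"
proof -
  have "inv x \<in> E" if x: "x \<in> E - {\<zero>}" for x
  proof -
    have xc: "x \<in> carrier \<Omega>" using x subringE(1)[OF assms(1)] by auto
    have "subfield (simple_extension K x) \<Omega>"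
      using simple_extension_is_subfield[OF subfield_axioms xc] algebraic_extension[OF xc] by simp
    moreover have "x \<in> simple_extension K x"
      using simple_extension_mem[OF subfieldE(1)[OF subfield_axioms] xc] .
    ultimately have "inv x \<in> simple_extension K x" using subfield_m_inv(1) x by blast
    then show ?thesis using simple_extension_subring_incl[OF assms] x by blast
  qed
  then show ?thesis using subfieldI'[OF assms(1)] assms(2) unfolding intermediate_def by blast
qed

lemma Irr_intermediate:
  assumes "intermediate E" "x \<in> carrier \<Omega>"
  shows "Irr E x \<in> carrier (E[X])" "pirreducible E (Irr E x)" "lead_coeff (Irr E x) = \<one>"
    "eval (Irr E x) x = \<zero>" "Irr E x \<noteq> []" "Irr E x \<in> carrier (poly_ring \<Omega>)"
proof -
  show Irr: "Irr E x \<in> carrier (E[X])" "pirreducible E (Irr E x)" "lead_coeff (Irr E x) = \<one>"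
    "eval (Irr E x) x = \<zero>"
    using IrrE[OF intermediateD(1)[OF assms(1)] assms(2)] intermediate_algebraic[OF assms]
    unfolding over_def by blast+
  show "Irr E x \<noteq> []" using pirreducibleE(1)[OF intermediateD(2)[OF assms(1)] Irr(1,2)] .
  show "Irr E x \<in> carrier (poly_ring \<Omega>)"
    using carrier_polynomial_shell[OF intermediateD(2)[OF assms(1)] Irr(1)] .
qed

lemma Irr_intermediate_minimal:
  assumes "intermediate E" "x \<in> carrier \<Omega>" "p \<in> carrier (E[X])" "eval p x = \<zero>"
  shows "Irr E x pdivides p"
  using Irr_minimal[OF intermediateD(1)[OF assms(1)] assms(2)] intermediate_algebraic[OF assms(1,2)] assms(3,4)
  unfolding over_def by blast

text \<open>This is the substitution that applies \<open>h\<close> to the coefficients and sends X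
  to \<open>y\<close>. When it kills the minimal polynomial of x over \<open>D\<close>, it induces
  the extension of \<open>h\<close> that sends x to \<open>y\<close>.\<close>

lemma eval_map_hom:
  assumes "subfield D \<Omega>" "h \<in> ring_hom (\<Omega>\<lparr>carrier := D\<rparr>) \<Omega>" "y \<in> carrier \<Omega>"
  shows "(\<lambda>p. eval (map h p) y) \<in> ring_hom (D[X]) \<Omega>"
proof -
  note D = subfieldE(1)[OF assms(1)]
  interpret h: ring_hom_ring "\<Omega>\<lparr>carrier := D\<rparr>" \<Omega> h
    using ring_hom_ringI2[OF subring_is_ring[OF D] ring_axioms assms(2)] .
  have D_set: "set p \<subseteq> D" if "p \<in> carrier (D[X])" for p
    using that polynomial_incl unfolding univ_poly_carrier[symmetric] by blast
  have h_set: "set (map h p) \<subseteq> carrier \<Omega>" if "set p \<subseteq> D" for p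
    using that h.hom_closed by auto
  have norm: "eval (normalize (map h p)) y = eval (map h p) y" if "set p \<subseteq> D" for p
    using eval_normalize[OF h_set[OF that] assms(3)] .
  show ?thesis
  proof (rule ring_hom_memI)
    fix p q assume "p \<in> carrier (D[X])" "q \<in> carrier (D[X])"
    note pq = D_set[OF this(1)] D_set[OF this(2)]
    have "set (poly_mult p q) \<subseteq> D" "set (poly_add p q) \<subseteq> D"
      using poly_mult_is_polynomial[OF D pq] poly_add_is_polynomial[OF D pq] polynomial_incl by blast+
    then show "eval (map h (p \<otimes>\<^bsub>D[X]\<^esub> q)) y = eval (map h p) y \<otimes> eval (map h q) y"
      and "eval (map h (p \<oplus>\<^bsub>D[X]\<^esub> q)) y = eval (map h p) y \<oplus> eval (map h q) y"
      using h.poly_mult_hom'[of p q] h.poly_add_hom'[of p q] pq norm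
        eval_poly_mult[OF h_set[OF pq(1)] h_set[OF pq(2)] assms(3)]
        eval_poly_add[OF h_set[OF pq(1)] h_set[OF pq(2)] assms(3)]
      unfolding univ_poly_mult univ_poly_add poly_mult_consistent[OF D] poly_add_consistent[OF D]
      by (simp_all del: poly_mult.simps poly_add.simps) metis+
  next
    fix p assume "p \<in> carrier (D[X])"
    then show "eval (map h p) y \<in> carrier \<Omega>" using eval_in_carrier[OF h_set[OF D_set] assms(3)] by blast
  next
    show "eval (map h \<one>\<^bsub>D[X]\<^esub>) y = \<one>" using h.hom_one assms(3) by (simp add: univ_poly_one)
  qed
qed

text \<open>A homomorphism from an intermediate field to \<open>\<Omega>\<close> that fixes \<open>E\<close> is represented by its graph, a
  subring of \<open>\<Omega> \<times> \<Omega>\<close>, so that unions of chains need no choice of representatives.\<close>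

definition hom_graph :: "'a set \<Rightarrow> ('a \<times> 'a) set \<Rightarrow> bool" where
  "hom_graph E R \<longleftrightarrow> R \<subseteq> carrier \<Omega> \<times> carrier \<Omega> \<and> (\<forall>x\<in>E. (x, x) \<in> R) \<and>
     (\<forall>a b c d. (a, b) \<in> R \<and> (c, d) \<in> R \<longrightarrow>
        (a \<oplus> c, b \<oplus> d) \<in> R \<and> (a \<otimes> c, b \<otimes> d) \<in> R \<and> (\<ominus> a, \<ominus> b) \<in> R) \<and>
     (\<forall>b. (\<zero>, b) \<in> R \<longrightarrow> b = \<zero>)"

definition graph_fun :: "('a \<times> 'a) set \<Rightarrow> 'a \<Rightarrow> 'a" where
  "graph_fun R a = (THE b. (a, b) \<in> R)"

text \<open>Single-valuedness at \<zero> suffices: two values over the same \<open>a\<close> differ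
  by a value over \<zero>.\<close>

lemma graph_fun_eq:
  assumes "hom_graph E R" "(a, b) \<in> R" shows "graph_fun R a = b"
proof -
  have "c = b" if c: "(a, c) \<in> R" for c
  proof -
    have cr: "a \<in> carrier \<Omega>" "b \<in> carrier \<Omega>" "c \<in> carrier \<Omega>"
      using assms c unfolding hom_graph_def by auto
    have "(a \<oplus> \<ominus> a, c \<oplus> \<ominus> b) \<in> R" using assms c unfolding hom_graph_def by blast
    then have "c \<oplus> \<ominus> b = \<zero>" using assms cr unfolding hom_graph_def by (simp add: r_neg)
    then show ?thesis using cr by (simp add: minus_eq[symmetric] r_right_minus_eq)
  qed
  then show ?thesis unfolding graph_fun_def using assms(2) by blast
qed

lemma hom_graph_Domain:
  assumes "intermediate E" "hom_graph E R"
  shows "intermediate (Domain R)" "E \<subseteq> Domain R" "graph_fun R \<in> ring_hom (\<Omega>\<lparr>carrier := Domain R\<rparr>) \<Omega>"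
    "\<And>x. x \<in> E \<Longrightarrow> graph_fun R x = x"
proof -
  note R = assms(2)[unfolded hom_graph_def]
  show E: "E \<subseteq> Domain R" using R by blast
  have "\<one> \<in> Domain R" using E subringE(3)[OF intermediateD(2)[OF assms(1)]] by blast
  then have "subring (Domain R) \<Omega>"
    using R by (intro subringI) (blast+)
  then show "intermediate (Domain R)"
    using intermediateI intermediateD(4)[OF assms(1)] E by blast
  show fixE: "graph_fun R x = x" if "x \<in> E" for x using graph_fun_eq[OF assms(2)] that R by blast
  have mem: "(a, graph_fun R a) \<in> R" if "a \<in> Domain R" for a
    using that graph_fun_eq[OF assms(2)] by blast
  show "graph_fun R \<in> ring_hom (\<Omega>\<lparr>carrier := Domain R\<rparr>) \<Omega>"
  proof (rule ring_hom_memI; simp)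
    show "graph_fun R \<one> = \<one>" using fixE subringE(3)[OF intermediateD(2)[OF assms(1)]] by blast
  next
    fix a assume "a \<in> Domain R"
    then show "graph_fun R a \<in> carrier \<Omega>" using mem R by blast
  next
    fix a b assume "a \<in> Domain R" "b \<in> Domain R"
    note m = mem[OF this(1)] mem[OF this(2)]
    have "(a \<otimes> b, graph_fun R a \<otimes> graph_fun R b) \<in> R" "(a \<oplus> b, graph_fun R a \<oplus> graph_fun R b) \<in> R"
      using R m by blast+
    then show "graph_fun R (a \<otimes> b) = graph_fun R a \<otimes> graph_fun R b"
      "graph_fun R (a \<oplus> b) = graph_fun R a \<oplus> graph_fun R b"
      using graph_fun_eq[OF assms(2)] by blast+
  qed
qed

text \<open>The new graph is the image of D[X] under p \<mapsto> (p(x), p^h(y)), where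
  \<open>h\<close> acts on the coefficients of p. It is single-valued because p(x) = 0 makes p a
  multiple of the minimal polynomial of x, whose transport vanishes at \<open>y\<close> by
  \<open>root\<close>.\<close>

lemma hom_graph_extend:
  assumes E: "intermediate E" and R: "hom_graph E R" and x: "x \<in> carrier \<Omega>" and y: "y \<in> carrier \<Omega>"
    and root: "eval (map (graph_fun R) (Irr (Domain R) x)) y = \<zero>"
  obtains R' where "hom_graph E R'" "R \<subseteq> R'" "(x, y) \<in> R'"
proof -
  define D where "D = Domain R"
  define h where "h = graph_fun R"
  define \<phi> where "\<phi> = (\<lambda>p. eval (map h p) y)"
  note D = hom_graph_Domain[OF E R, folded D_def h_def]
  note Ds = intermediateD(1,2)[OF D(1)]
  interpret UP: domain "D[X]" using univ_poly_is_domain[OF Ds(2)] .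
  interpret e: ring_hom_ring "D[X]" \<Omega> "\<lambda>p. eval p x" using eval_ring_hom[OF Ds(2) x] .
  interpret f: ring_hom_ring "D[X]" \<Omega> \<phi>
    using ring_hom_ringI2[OF UP.ring_axioms ring_axioms] eval_map_hom[OF Ds(1) D(3) y]
    unfolding \<phi>_def by blast
  define R' where "R' = (\<lambda>p. (eval p x, \<phi> p)) ` carrier (D[X])"
  have zero: "\<phi> p = \<zero>" if p: "p \<in> carrier (D[X])" "eval p x = \<zero>" for p
  proof -
    note Irr = Irr_intermediate(1)[OF D(1) x]
    have "Irr D x divides\<^bsub>D[X]\<^esub> p"
      using Irr_intermediate_minimal[OF D(1) x p] pdivides_iff_shell[OF Ds(1) Irr p(1)] by simp
    then obtain q where q: "q \<in> carrier (D[X])" "p = Irr D x \<otimes>\<^bsub>D[X]\<^esub> q"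
      unfolding factor_def by blast
    moreover have "\<phi> (Irr D x) = \<zero>" using root unfolding \<phi>_def h_def D_def .
    ultimately show ?thesis using f.hom_mult[OF Irr q(1)] f.hom_closed[OF q(1)] by simp
  qed
  \<comment> \<open>The case distinction is due to the representation: the constant zero is the
    empty list, not \<open>[a]\<close>.\<close>
  have const: "(a, h a) \<in> R'" if "a \<in> D" for a
  proof (cases "a = \<zero>")
    case True
    have "h \<zero> = \<zero>" using D(4)[OF subringE(2)[OF intermediateD(2)[OF E]]] .
    then have "([] :: 'a list) \<in> carrier (D[X])" "(a, h a) = (eval [] x, \<phi> [])"
      using True unfolding \<phi>_def univ_poly_carrier[symmetric] by auto
    then show ?thesis unfolding R'_def by blast
  next
    case False
    have "h a \<in> carrier \<Omega>" "a \<in> carrier \<Omega>"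
      using ring_hom_closed[OF D(3)] that subringE(1)[OF Ds(2)] by auto
    then have "[a] \<in> carrier (D[X])" "(a, h a) = (eval [a] x, \<phi> [a])"
      using that False x y unfolding \<phi>_def univ_poly_carrier[symmetric] polynomial_def by auto
    then show ?thesis unfolding R'_def by blast
  qed
  have "hom_graph E R'"
    unfolding hom_graph_def
  proof (intro conjI allI ballI impI; (elim conjE)?)
    show "R' \<subseteq> carrier \<Omega> \<times> carrier \<Omega>" using e.hom_closed f.hom_closed unfolding R'_def by auto
    show "(a, a) \<in> R'" if "a \<in> E" for a using const D(2,4) that by fastforce
    show "b = \<zero>" if "(\<zero>, b) \<in> R'" for b using that zero unfolding R'_def by auto
    fix a b c d assume "(a, b) \<in> R'" "(c, d) \<in> R'"
    then obtain p q where p: "p \<in> carrier (D[X])" "a = eval p x" "b = \<phi> p"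
      and q: "q \<in> carrier (D[X])" "c = eval q x" "d = \<phi> q"
      unfolding R'_def by auto
    show "(a \<oplus> c, b \<oplus> d) \<in> R'"
      using e.hom_add[OF p(1) q(1)] f.hom_add[OF p(1) q(1)] p q UP.a_closed[OF p(1) q(1)]
      unfolding R'_def by (metis (no_types, lifting) image_eqI)
    show "(a \<otimes> c, b \<otimes> d) \<in> R'"
      using e.hom_mult[OF p(1) q(1)] f.hom_mult[OF p(1) q(1)] p q UP.m_closed[OF p(1) q(1)]
      unfolding R'_def by (metis (no_types, lifting) image_eqI)
    show "(\<ominus> a, \<ominus> b) \<in> R'"
      using e.hom_a_inv[OF p(1)] f.hom_a_inv[OF p(1)] p UP.a_inv_closed[OF p(1)]
      unfolding R'_def by (metis (no_types, lifting) image_eqI)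
  qed
  moreover have "R \<subseteq> R'"
  proof
    fix r assume r: "r \<in> R"
    obtain a b where ab: "r = (a, b)" by (cases r)
    then have "b = h a" "a \<in> D" using graph_fun_eq[OF R] r unfolding h_def D_def by auto
    then show "r \<in> R'" using const ab by simp
  qed
  moreover have "(x, y) \<in> R'"
  proof -
    have "h \<zero> = \<zero>" "h \<one> = \<one>"
      using D(4) subringE(2,3)[OF intermediateD(2)[OF E]] by blast+
    then have "(x, y) = (eval X x, \<phi> X)"
      using eval_var[OF x] eval_var[OF y] unfolding \<phi>_def var_def by simp
    then show ?thesis using var_closed(1)[OF Ds(2)] unfolding R'_def by blast
  qed
  ultimately show thesis using that by blast
qed

lemma exists_root_in_closure:
  assumes "p \<in> carrier (poly_ring \<Omega>)" "degree p \<ge> 1"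
  obtains y where "y \<in> carrier \<Omega>" "eval p y = \<zero>"
proof -
  have "roots p \<noteq> {#}" using roots_over_carrier[OF assms(1)] assms(2) unfolding splitted_def by auto
  then obtain y where "y \<in># roots p" by blast
  then show thesis using that roots_mem_iff_is_root[OF assms(1)] unfolding is_root_def by blast
qed

text \<open>The graph on E(x) that sends x to y lies in a maximal one. If z were outside its domain,
  the transported minimal polynomial of z would have a root in \<Omega>, to which z could be
  sent.\<close>

theorem endos_transitive:
  assumes E: "intermediate E" and x: "x \<in> carrier \<Omega>" and y: "y \<in> carrier \<Omega>"
    and root: "eval (Irr E x) y = \<zero>"
  obtains \<tau> where "\<tau> \<in> endos E" "\<tau> x = y"
proof -
  define R0 where "R0 = (\<lambda>x. (x, x)) ` E"
  have R0: "hom_graph E R0"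
    using intermediateD(3)[OF E] subringE(2,5-7)[OF intermediateD(2)[OF E]]
    unfolding hom_graph_def R0_def by auto
  have D0: "Domain R0 = E" unfolding R0_def by auto
  have "set (Irr E x) \<subseteq> E"
    using Irr_intermediate(1)[OF E x] polynomial_incl unfolding univ_poly_carrier[symmetric] by blast
  then have "map (graph_fun R0) (Irr E x) = Irr E x"
    using hom_graph_Domain(4)[OF E R0] by (intro map_idI) auto
  then obtain R1 where R1: "hom_graph E R1" "(x, y) \<in> R1"
    using hom_graph_extend[OF E R0 x y] root unfolding D0 by auto
  let ?A = "{R. hom_graph E R \<and> R1 \<subseteq> R}"
  have "\<exists>M\<in>?A. \<forall>R\<in>?A. M \<subseteq> R \<longrightarrow> R = M"
  proof (rule subset_Zorn_nonempty)
    show "?A \<noteq> {}" using R1 by blast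
  next
    fix C assume C: "C \<noteq> {}" "subset.chain ?A C"
    then have mem: "\<And>R. R \<in> C \<Longrightarrow> hom_graph E R \<and> R1 \<subseteq> R" unfolding subset.chain_def by blast
    have two: "\<exists>R\<in>C. r \<in> R \<and> s \<in> R" if "r \<in> \<Union>C" "s \<in> \<Union>C" for r s
      using that C(2) unfolding subset.chain_def by blast
    have "hom_graph E (\<Union>C)"
      unfolding hom_graph_def
    proof (intro conjI allI ballI impI; (elim conjE)?)
      show "\<Union>C \<subseteq> carrier \<Omega> \<times> carrier \<Omega>" using mem unfolding hom_graph_def by blast
      show "(a, a) \<in> \<Union>C" if "a \<in> E" for a using mem C(1) that unfolding hom_graph_def by blast
      show "b = \<zero>" if "(\<zero>, b) \<in> \<Union>C" for b using mem that unfolding hom_graph_def by blast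
      fix a b c d assume "(a, b) \<in> \<Union>C" "(c, d) \<in> \<Union>C"
      then obtain R where "R \<in> C" "(a, b) \<in> R" "(c, d) \<in> R" using two by blast
      then show "(a \<oplus> c, b \<oplus> d) \<in> \<Union>C" "(a \<otimes> c, b \<otimes> d) \<in> \<Union>C" "(\<ominus> a, \<ominus> b) \<in> \<Union>C"
        using mem unfolding hom_graph_def by blast+
    qed
    then show "\<Union>C \<in> ?A" using mem C(1) by blast
  qed
  then obtain M where MA: "M \<in> ?A" "\<forall>R\<in>?A. M \<subseteq> R \<longrightarrow> R = M" ..
  then have M: "hom_graph E M" "R1 \<subseteq> M" by simp_all
  have max: "R = M" if "hom_graph E R" "M \<subseteq> R" for R
    using bspec[OF MA(2), of R] subset_trans[OF M(2) that(2)] that by simp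
  note D = hom_graph_Domain[OF E M(1)]
  have "Domain M = carrier \<Omega>"
  proof
    show "Domain M \<subseteq> carrier \<Omega>" using intermediateD(3)[OF D(1)] .
    show "carrier \<Omega> \<subseteq> Domain M"
    proof
      fix z assume z: "z \<in> carrier \<Omega>"
      let ?f = "Irr (Domain M) z"
      note Irr = Irr_intermediate[OF D(1) z]
      have "map (graph_fun M) ?f \<in> carrier (poly_ring \<Omega>)"
      proof -
        have "graph_fun M \<one> = \<one>"
          using D(4) subringE(3)[OF intermediateD(2)[OF E]] by blast
        moreover have "set ?f \<subseteq> Domain M"
          using Irr(1) polynomial_incl unfolding univ_poly_carrier[symmetric] by blast
        ultimately show ?thesis
          using Irr(3,5) ring_hom_closed[OF D(3)]
          unfolding univ_poly_carrier[symmetric] polynomial_def by (auto simp: hd_map)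
      qed
      moreover have "degree (map (graph_fun M) ?f) \<ge> 1"
        using pirreducible_degree[OF intermediateD(1)[OF D(1)] Irr(1,2)] by simp
      ultimately obtain w where "w \<in> carrier \<Omega>" "eval (map (graph_fun M) ?f) w = \<zero>"
        using exists_root_in_closure by blast
      then obtain M' where "hom_graph E M'" "M \<subseteq> M'" "(z, w) \<in> M'"
        using hom_graph_extend[OF E M(1) z] by blast
      then show "z \<in> Domain M" using max by blast
    qed
  qed
  then have "graph_fun M \<in> endos E" using D(3,4) unfolding endos_def by simp
  moreover have "graph_fun M x = y" using graph_fun_eq[OF M(1)] R1(2) M(2) by blast
  ultimately show thesis using that by blast
qed

subsection \<open>Conjugates, separability and purely inseparable extensions\<close>

lemma endosD:
  assumes "\<tau> \<in> endos E"
  shows "\<tau> \<in> ring_hom \<Omega> \<Omega>" "\<And>x. x \<in> E \<Longrightarrow> \<tau> x = x" "\<And>x. x \<in> carrier \<Omega> \<Longrightarrow> \<tau> x \<in> carrier \<Omega>"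
    "ring_hom_ring \<Omega> \<Omega> \<tau>"
  using assms ring_hom_closed ring_hom_ringI2[OF ring_axioms ring_axioms] unfolding endos_def by auto

lemma endos_mono: "E \<subseteq> F \<Longrightarrow> endos F \<subseteq> endos E"
  unfolding endos_def by auto

lemma endos_comp: "\<tau> \<in> endos E \<Longrightarrow> \<rho> \<in> endos E \<Longrightarrow> \<tau> \<circ> \<rho> \<in> endos E"
  unfolding endos_def using ring_hom_trans by fastforce

lemma endos_inj: "\<tau> \<in> endos E \<Longrightarrow> inj_on \<tau> (carrier \<Omega>)"
  using ring_hom_ring.img_is_subfield(1)[OF endosD(4) carrier_is_subfield one_not_zero] .

lemma set_poly_subset: "p \<in> carrier (E[X]) \<Longrightarrow> set p \<subseteq> E"
  using polynomial_incl unfolding univ_poly_carrier[symmetric] by blast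

lemma endos_root:
  assumes "intermediate E" "\<tau> \<in> endos E" "p \<in> carrier (E[X])" "x \<in> carrier \<Omega>" "eval p x = \<zero>"
  shows "eval p (\<tau> x) = \<zero>"
proof -
  interpret s: ring_hom_ring \<Omega> \<Omega> \<tau> using endosD(4)[OF assms(2)] .
  have "map \<tau> p = p"
    using set_poly_subset[OF assms(3)] endosD(2)[OF assms(2)] by (intro map_idI) auto
  then show ?thesis
    using s.eval_hom[OF intermediateD(2)[OF assms(1)] assms(4,3)] assms(5) by simp
qed

section \<open>Fields cut out by endomorphisms\<close>

lemma intermediate_Inter:
  assumes "A \<noteq> {}" "\<And>E. E \<in> A \<Longrightarrow> intermediate E" shows "intermediate (\<Inter>A)"
  using subring_Inter[of A] assms intermediateD(2,4) by (intro intermediateI) blast+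

lemma intermediate_Int:
  assumes "intermediate E" "intermediate F" shows "intermediate (E \<inter> F)"
  using intermediate_Inter[of "{E, F}"] assms by auto

lemma intermediate_carrier: "intermediate (carrier \<Omega>)"
  using intermediateI[OF carrier_is_subring] intermediateD(3)[OF intermediate_ground] .

text \<open>An intersection of preimages of \<open>L\<close>. Because it is a field, having all
  images inside \<open>L\<close> needs to be tested on generators only.\<close>

lemma intermediate_stable:
  assumes "intermediate L" "S \<subseteq> endos K"
  shows "intermediate {x \<in> carrier \<Omega>. \<forall>\<tau>\<in>S. \<tau> x \<in> L}"
proof -
  have "intermediate {x \<in> carrier \<Omega>. \<tau> x \<in> L}" if "\<tau> \<in> endos K" for \<tau>
  proof -
    interpret t: ring_hom_ring \<Omega> \<Omega> \<tau> using endosD(4)[OF that] .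
    show ?thesis
      using subringE[OF intermediateD(2)[OF assms(1)]] intermediateD(3)[OF intermediate_ground]
        intermediateD(4)[OF assms(1)] endosD(2)[OF that]
      by (intro intermediateI subringI) auto
  qed
  \<comment> \<open>Inserting the whole carrier gives the intersection its meaning when
    \<open>S\<close> is empty.\<close>
  then have "intermediate (\<Inter>(insert (carrier \<Omega>) ((\<lambda>\<tau>. {x \<in> carrier \<Omega>. \<tau> x \<in> L}) ` S)))"
    using assms(2) intermediate_carrier by (intro intermediate_Inter) auto
  moreover have "{x \<in> carrier \<Omega>. \<forall>\<tau>\<in>S. \<tau> x \<in> L}
      = \<Inter>(insert (carrier \<Omega>) ((\<lambda>\<tau>. {x \<in> carrier \<Omega>. \<tau> x \<in> L}) ` S))" by auto
  ultimately show ?thesis by simp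
qed

lemma intermediate_fixed:
  assumes "S \<subseteq> endos K"
  shows "intermediate {x \<in> carrier \<Omega>. \<forall>\<tau>\<in>S. \<tau> x = x}"
proof -
  have "intermediate {x \<in> carrier \<Omega>. \<tau> x = x}" if "\<tau> \<in> endos K" for \<tau>
  proof -
    interpret t: ring_hom_ring \<Omega> \<Omega> \<tau> using endosD(4)[OF that] .
    show ?thesis
      using intermediateD(3)[OF intermediate_ground] endosD(2)[OF that]
      by (intro intermediateI subringI) auto
  qed
  then have "intermediate (\<Inter>(insert (carrier \<Omega>) ((\<lambda>\<tau>. {x \<in> carrier \<Omega>. \<tau> x = x}) ` S)))"
    using assms intermediate_carrier by (intro intermediate_Inter) auto
  moreover have "{x \<in> carrier \<Omega>. \<forall>\<tau>\<in>S. \<tau> x = x}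
      = \<Inter>(insert (carrier \<Omega>) ((\<lambda>\<tau>. {x \<in> carrier \<Omega>. \<tau> x = x}) ` S))" by auto
  ultimately show ?thesis by simp
qed

section \<open>Conjugates and their number\<close>

abbreviation "conjugates E x \<equiv> {y. is_root (Irr E x) y}"

lemma conjugates_eq_orbit:
  assumes "intermediate E" "x \<in> carrier \<Omega>"
  shows "conjugates E x = (\<lambda>\<tau>. \<tau> x) ` endos E"
proof (intro equalityI subsetI)
  fix y assume "y \<in> conjugates E x"
  then have "y \<in> carrier \<Omega>" "eval (Irr E x) y = \<zero>" unfolding is_root_def by auto
  then obtain \<tau> where "\<tau> \<in> endos E" "\<tau> x = y" using endos_transitive[OF assms] by blast
  then show "y \<in> (\<lambda>\<tau>. \<tau> x) ` endos E" by blast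
next
  fix y assume "y \<in> (\<lambda>\<tau>. \<tau> x) ` endos E"
  then show "y \<in> conjugates E x"
    using endos_root[OF assms(1) _ Irr_intermediate(1)[OF assms] assms(2) Irr_intermediate(4)[OF assms]]
      endosD(3) assms(2) Irr_intermediate(5)[OF assms] unfolding is_root_def by auto
qed

lemma card_conjugates_le:
  assumes "intermediate E" "x \<in> carrier \<Omega>"
  shows "card (conjugates E x) \<le> degree (Irr E x)"
proof -
  note Irr = Irr_intermediate(6)[OF assms]
  have "conjugates E x = set_mset (roots (Irr E x))" using roots_mem_iff_is_root[OF Irr] by auto
  moreover have "card (set_mset (roots (Irr E x))) \<le> size (roots (Irr E x))"
    using size_mset_mono[OF mset_set_set_mset_msubset[of "roots (Irr E x)"]] by simp
  ultimately show ?thesis using size_roots_le_degree[OF Irr] by simp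
qed

text \<open>With simple roots the multiset of roots is a set, and its size is the degree because
  \<Omega> is algebraically closed.\<close>

lemma separable_card_conjugates:
  assumes "intermediate E" "x \<in> carrier \<Omega>" "separable_elem \<Omega> E x"
  shows "card (conjugates E x) = degree (Irr E x)"
proof -
  note Irr = Irr_intermediate(6)[OF assms(1,2)]
  let ?m = "roots (Irr E x)"
  have "count ?m a = count (mset_set (set_mset ?m)) a" for a
  proof (cases "a \<in># ?m")
    case True
    then have "a \<in> carrier \<Omega>" using roots_mem_iff_is_root[OF Irr] unfolding is_root_def by blast
    then have "count ?m a \<le> 1"
      using assms(3) alg_mult_eq_count_roots[OF Irr] unfolding separable_elem_def by simp
    moreover have "count ?m a \<ge> 1" using True by (simp add: Suc_leI)
    ultimately have "count ?m a = 1" by linarith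
    then show ?thesis using True by simp
  qed (simp add: not_in_iff)
  then have "?m = mset_set (set_mset ?m)" by (rule multiset_eqI)
  then have "size ?m = card (set_mset ?m)" by (metis size_mset_set)
  moreover have "conjugates E x = set_mset ?m" using roots_mem_iff_is_root[OF Irr] by auto
  ultimately show ?thesis using roots_over_carrier[OF Irr] unfolding splitted_def by simp
qed

text \<open>The minimal polynomial divides \<open>p\<close> and inherits simple roots. Separability
  can thus be read off from any annihilating polynomial at hand.\<close>

lemma separable_elem_of_dvd:
  assumes "intermediate E" "x \<in> carrier \<Omega>" "p \<in> carrier (E[X])" "p \<noteq> []" "eval p x = \<zero>"
    and "\<And>a. count (roots p) a \<le> 1"
  shows "separable_elem \<Omega> E x"
proof -
  have "p \<in> carrier (poly_ring \<Omega>)" using carrier_polynomial_shell[OF intermediateD(2)[OF assms(1)] assms(3)] .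
  then have "roots (Irr E x) \<subseteq># roots p"
    using pdivides_imp_roots_incl[OF Irr_intermediate(6)[OF assms(1,2)] _ assms(4)
        Irr_intermediate_minimal[OF assms(1,2,3,5)]] by blast
  then have "alg_mult (Irr E x) a \<le> 1" for a
    using alg_mult_eq_count_roots[OF Irr_intermediate(6)[OF assms(1,2)]] assms(6)[of a]
      mset_subset_eq_count[of "roots (Irr E x)" "roots p" a] by simp
  then show ?thesis
    using intermediate_algebraic[OF assms(1,2)] unfolding separable_elem_def by simp
qed

lemma separable_elem_mono:
  assumes "intermediate E" "intermediate F" "E \<subseteq> F" "x \<in> carrier \<Omega>" "separable_elem \<Omega> E x"
  shows "separable_elem \<Omega> F x"
proof (rule separable_elem_of_dvd[OF assms(2,4)])
  note Irr = Irr_intermediate[OF assms(1,4)]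
  show "Irr E x \<in> carrier (F[X])"
    using Irr(1) assms(3) unfolding univ_poly_carrier[symmetric] polynomial_def by auto
  show "Irr E x \<noteq> []" "eval (Irr E x) x = \<zero>" using Irr by auto
  show "count (roots (Irr E x)) a \<le> 1" for a
  proof (cases "a \<in> carrier \<Omega>")
    case False
    then show ?thesis
      using roots_mem_iff_is_root[OF Irr(6), of a] unfolding is_root_def by (simp add: not_in_iff)
  qed (use assms(5) alg_mult_eq_count_roots[OF Irr(6)] in \<open>simp add: separable_elem_def\<close>)
qed

section \<open>Fixed points and pure inseparability\<close>

lemma endos_fixes_pow_imp_fixes:
  assumes "\<tau> \<in> endos E" "prime (p::nat)" "add_pow \<Omega> p \<one> = \<zero>" "x \<in> carrier \<Omega>" "\<tau> (x [^] p) = x [^] p"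
  shows "\<tau> x = x"
proof -
  interpret s: ring_hom_ring \<Omega> \<Omega> \<tau> using endosD(4)[OF assms(1)] .
  have "\<tau> x [^] p = x [^] p"
    using assms(4,5) s.hom_nat_pow by simp
  then show ?thesis using frobenius_inj[OF assms(2,3)] assms(4) by simp
qed

text \<open>Inseparable elements are reached from separable ones by extracting \<open>p\<close>-th roots, which are
  unique in characteristic \<open>p\<close>.\<close>

lemma endos_fixes_of_separable:
  assumes "intermediate E" "\<And>x. x \<in> E \<Longrightarrow> separable_elem \<Omega> K x \<Longrightarrow> x \<in> M"
    and "\<tau> \<in> endos M" "x \<in> E"
  shows "\<tau> x = x"
  using assms(4)
proof (induct "degree (Irr K x)" arbitrary: x rule: less_induct)
  case less
  have x: "x \<in> carrier \<Omega>" using less(2) intermediateD(3)[OF assms(1)] by blast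
  show ?case
  proof (cases "separable_elem \<Omega> K x")
    case True
    then show ?thesis using assms(2,3) less(2) endosD(2) by blast
  next
    case False
    with inseparable_imp_degree_Irr_pow_less[OF subfield_axioms x
        intermediate_algebraic[OF intermediate_ground x]]
    obtain p :: nat where p: "prime p" "add_pow \<Omega> p \<one> = \<zero>" "degree (Irr K (x [^] p)) < degree (Irr K x)"
      by metis
    have "x [^] n \<in> E" for n :: nat
      using less(2) subringE(3,6)[OF intermediateD(2)[OF assms(1)]] by (induct n) auto
    then show ?thesis
      using endos_fixes_pow_imp_fixes[OF assms(3) p(1,2) x less(1)[OF p(3)]] by simp
  qed
qed

lemma degree_Irr_eq_1_imp_mem:
  assumes "intermediate E" "x \<in> carrier \<Omega>" "degree (Irr E x) = 1" shows "x \<in> E"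
proof -
  note Irr = Irr_intermediate[OF assms(1,2)]
  obtain a b where ab: "a \<in> E" "b \<in> E" "Irr E x = [a, b]"
    using degree_oneE[OF Irr(1) assms(3)] by metis
  then have "x \<oplus> b = \<zero>" "b \<in> carrier \<Omega>"
    using Irr(3,4) assms(2) intermediateD(3)[OF assms(1)] by auto
  then have "x = \<ominus> b" using assms(2) minus_equality by metis
  then show ?thesis using ab(2) subringE(5)[OF intermediateD(2)[OF assms(1)]] by simp
qed

text \<open>The number of conjugates of a separable element is its degree, so an orbit of one
  element means degree one.\<close>

lemma separable_fixed_imp_mem:
  assumes "intermediate E" "x \<in> carrier \<Omega>" "separable_elem \<Omega> E x" "\<And>\<tau>. \<tau> \<in> endos E \<Longrightarrow> \<tau> x = x"
  shows "x \<in> E"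
proof -
  have "x \<in> conjugates E x" using Irr_intermediate[OF assms(1,2)] assms(2) unfolding is_root_def by simp
  moreover have "conjugates E x \<subseteq> {x}" unfolding conjugates_eq_orbit[OF assms(1,2)] using assms(4) by auto
  ultimately have "conjugates E x = {x}" by blast
  then have "degree (Irr E x) = 1" using separable_card_conjugates[OF assms(1-3)] by simp
  then show ?thesis using degree_Irr_eq_1_imp_mem[OF assms(1,2)] by simp
qed

text \<open>The definition by absence of separable elements gives no closure under addition. The
  fixed-point form does.\<close>

lemma purely_insep_iff:
  assumes "intermediate E"
  shows "purely_insep_ext \<Omega> K E \<longleftrightarrow> (\<forall>x\<in>E. \<forall>\<tau>\<in>endos K. \<tau> x = x)"
proof
  assume E: "purely_insep_ext \<Omega> K E"
  have "x \<in> K" if "x \<in> E" "separable_elem \<Omega> K x" for x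
    using E that unfolding purely_insep_ext_def by blast
  then show "\<forall>x\<in>E. \<forall>\<tau>\<in>endos K. \<tau> x = x" using endos_fixes_of_separable[OF assms] by blast
next
  assume "\<forall>x\<in>E. \<forall>\<tau>\<in>endos K. \<tau> x = x"
  then show "purely_insep_ext \<Omega> K E"
    using separable_fixed_imp_mem[OF intermediate_ground] intermediateD(3)[OF assms]
      intermediate_algebraic[OF intermediate_ground]
    unfolding purely_insep_ext_def algebraic_ext_def by blast
qed

lemma max_purely_insep_eq:
  assumes "intermediate L"
  shows "max_purely_insep \<Omega> K L = {x \<in> L. \<forall>\<tau>\<in>endos K. \<tau> x = x}"
    and "intermediate (max_purely_insep \<Omega> K L)"
proof -
  let ?I = "{x \<in> L. \<forall>\<tau>\<in>endos K. \<tau> x = x}"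
  have "?I = L \<inter> {x \<in> carrier \<Omega>. \<forall>\<tau>\<in>endos K. \<tau> x = x}" using intermediateD(3)[OF assms] by auto
  then have I: "intermediate ?I"
    using intermediate_Int[OF assms intermediate_fixed[of "endos K"]] by simp
  show eq: "max_purely_insep \<Omega> K L = ?I"
    unfolding max_purely_insep_def
  proof (rule Greatest_equality)
    show "subextension \<Omega> K L ?I \<and> purely_insep_ext \<Omega> K ?I"
      using purely_insep_iff[OF I] intermediateD[OF I] unfolding subextension_def by auto
    fix E assume "subextension \<Omega> K L E \<and> purely_insep_ext \<Omega> K E"
    then show "E \<le> ?I"
      using purely_insep_iff[of E] unfolding subextension_def intermediate_def by blast
  qed
  show "intermediate (max_purely_insep \<Omega> K L)" using I eq by simp
qed

subsection \<open>Degrees and the separable closure\<close>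

lemma intermediate_finite_extension:
  assumes "intermediate E" "set xs \<subseteq> carrier \<Omega>"
  shows "intermediate (finite_extension E xs)" "E \<subseteq> finite_extension E xs"
    "set xs \<subseteq> finite_extension E xs" "finite_dimension E (finite_extension E xs)"
proof -
  show "E \<subseteq> finite_extension E xs"
    using finite_extension_incl[OF intermediateD(3)[OF assms(1)] assms(2)] .
  then show "intermediate (finite_extension E xs)"
    using intermediateI[OF finite_extension_is_subring[OF intermediateD(2)[OF assms(1)] assms(2)]]
      intermediateD(4)[OF assms(1)] by blast
  show "set xs \<subseteq> finite_extension E xs"
    using finite_extension_mem[OF intermediateD(2)[OF assms(1)] assms(2)] .
  show "finite_dimension E (finite_extension E xs)"
    using finite_extension_finite_dimension(1)[OF intermediateD(1)[OF assms(1)] assms(2)]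
      intermediate_algebraic[OF assms(1)] assms(2) unfolding over_def by blast
qed

lemma finite_extension_le:
  assumes "intermediate F" "E \<subseteq> F" "set xs \<subseteq> F" shows "finite_extension E xs \<subseteq> F"
  using finite_extension_subring_incl[OF intermediateD(2)[OF assms(1)] assms(2,3)] .

lemma dim_mult:
  assumes "intermediate E" "intermediate F" "finite_dimension E F" "finite_dimension F M"
  shows "finite_dimension E M" "dim E M = dim E F * dim F M"
  using telescopic_base_dim[OF intermediateD(1)[OF assms(1)] intermediateD(1)[OF assms(2)] assms(3,4)]
  unfolding over_def by auto

lemma dim_simple_extension:
  assumes "intermediate E" "x \<in> carrier \<Omega>"
  shows "dim E (simple_extension E x) = degree (Irr E x)" "finite_dimension E (simple_extension E x)"
  using simple_extension_dim[OF intermediateD(1)[OF assms(1)] assms(2)]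
    finite_dimension_simple_extension[OF intermediateD(1)[OF assms(1)] assms(2)]
    intermediate_algebraic[OF assms] unfolding over_def by auto

text \<open>The assumption \<open>fixed\<close> says that \<open>B\<close> is purely inseparable over \<open>A\<close>; the conclusion expresses
  linear disjointness.\<close>

lemma dim_finite_extension_separable:
  assumes A: "intermediate A" and B: "intermediate B" and "A \<subseteq> B"
    and fixed: "\<And>\<tau> x. \<tau> \<in> endos A \<Longrightarrow> x \<in> B \<Longrightarrow> \<tau> x = x"
    and xs: "set xs \<subseteq> carrier \<Omega>" "\<And>x. x \<in> set xs \<Longrightarrow> separable_elem \<Omega> A x"
  shows "dim B (finite_extension B xs) = dim A (finite_extension A xs)"
  using xs
proof (induct xs)
  case Nil
  have "dim E E = 1" if "intermediate E" for E
    using dimI[OF intermediateD(1)[OF that] dimension_one[OF intermediateD(1)[OF that]]]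
    unfolding over_def .
  then show ?case using A B by simp
next
  case (Cons x xs)
  let ?A = "finite_extension A xs" and ?B = "finite_extension B xs"
  have x: "x \<in> carrier \<Omega>" and xs: "set xs \<subseteq> carrier \<Omega>" using Cons(2) by auto
  note eA = intermediate_finite_extension[OF A xs] and eB = intermediate_finite_extension[OF B xs]
  have AB: "?A \<subseteq> ?B" using finite_extension_le[OF eB(1) _ eB(3)] eB(2) assms(3) by blast
  \<comment> \<open>The hypothesis \<open>fixed\<close> passes up the induction: an endomorphism
    over \<open>?A\<close> fixes both \<open>B\<close> and the adjoined elements, hence all of
    \<open>?B\<close>.\<close>
  have fixB: "\<tau> z = z" if "\<tau> \<in> endos ?A" "z \<in> ?B" for \<tau> z
  proof -
    have t: "\<tau> \<in> endos A" "\<tau> \<in> endos K"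
      using endos_mono[OF eA(2)] endos_mono[OF intermediateD(4)[OF eA(1)]] that(1) by blast+
    let ?F = "{x \<in> carrier \<Omega>. \<forall>\<rho>\<in>{\<tau>}. \<rho> x = x}"
    have "intermediate ?F" using intermediate_fixed[of "{\<tau>}"] t(2) by blast
    moreover have "B \<subseteq> ?F" using fixed[OF t(1)] intermediateD(3)[OF B] by auto
    moreover have "set xs \<subseteq> ?F" using endosD(2)[OF that(1)] eA(3) xs by auto
    ultimately have "?B \<subseteq> ?F" by (rule finite_extension_le)
    then show ?thesis using that(2) by blast
  qed
  have sep: "separable_elem \<Omega> ?A x"
    using separable_elem_mono[OF A eA(1,2) x] Cons(3) by simp
  \<comment> \<open>By \<open>fixB\<close> enlarging the base keeps all endomorphisms, so no
    conjugate is lost. As \<open>x\<close> is separable over \<open>?A\<close>, its conjugates there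
    number the degree, which therefore cannot drop over \<open>?B\<close>.\<close>
  have "conjugates ?A x \<subseteq> conjugates ?B x"
  proof -
    have "endos ?A \<subseteq> endos ?B" using fixB unfolding endos_def by auto
    then show ?thesis
      unfolding conjugates_eq_orbit[OF eA(1) x] conjugates_eq_orbit[OF eB(1) x] by blast
  qed
  then have "card (conjugates ?A x) \<le> card (conjugates ?B x)"
    using finite_number_of_roots[OF Irr_intermediate(6)[OF eB(1) x]] by (intro card_mono) auto
  then have "degree (Irr ?A x) \<le> degree (Irr ?B x)"
    using separable_card_conjugates[OF eA(1) x sep] card_conjugates_le[OF eB(1) x] by linarith
  moreover have "degree (Irr ?B x) \<le> degree (Irr ?A x)"
  proof -
    note Irr = Irr_intermediate[OF eA(1) x]
    have "Irr ?A x \<in> carrier (?B[X])"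
      using Irr(1) AB unfolding univ_poly_carrier[symmetric] polynomial_def by auto
    then show ?thesis
      using pdivides_imp_degree_le[OF intermediateD(2)[OF eB(1)] Irr_intermediate(1)[OF eB(1) x] _ Irr(5)]
        Irr_intermediate_minimal[OF eB(1) x _ Irr(4)] by blast
  qed
  ultimately have deg: "degree (Irr ?B x) = degree (Irr ?A x)" by linarith
  have "dim B (finite_extension B (x # xs)) = dim B ?B * degree (Irr ?B x)"
    "dim A (finite_extension A (x # xs)) = dim A ?A * degree (Irr ?A x)"
    using dim_mult(2)[OF B eB(1,4) dim_simple_extension(2)[OF eB(1) x]] dim_simple_extension(1)[OF eB(1) x]
      dim_mult(2)[OF A eA(1,4) dim_simple_extension(2)[OF eA(1) x]] dim_simple_extension(1)[OF eA(1) x]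
    by auto
  then show ?case using deg Cons by simp
qed

lemma intermediate_simple_extension:
  assumes "intermediate E" "x \<in> carrier \<Omega>"
  shows "intermediate (simple_extension E x)" "E \<subseteq> simple_extension E x" "x \<in> simple_extension E x"
  using intermediate_finite_extension[OF assms(1), of "[x]"] assms(2) by auto

lemma dim_pos:
  assumes "intermediate E" "finite_dimension E F" "\<one> \<in> F" shows "dim E F > 0"
proof (rule ccontr)
  assume "\<not> dim E F > 0"
  then have "dimension 0 E F"
    using finite_dimensionE[OF intermediateD(1)[OF assms(1)] assms(2)] unfolding over_def by simp
  then have "F = {\<zero>}" using dimension_zero[OF intermediateD(1)[OF assms(1)]] by blast
  then show False using assms(3) by simp
qed

lemma finite_dimension_subset:
  assumes "intermediate E" "intermediate F" "E \<subseteq> F" "F \<subseteq> M" "finite_dimension E M"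
  shows "finite_dimension E F"
proof (rule subalbegra_incl_imp_finite_dimension[OF intermediateD(1)[OF assms(1)] assms(5) _ assms(4)])
  show "subalgebra E F \<Omega>"
    using subringE(6)[OF intermediateD(2)[OF assms(2)]] assms(3) subring.axioms(1)[OF intermediateD(2)[OF assms(2)]]
    unfolding subalgebra_def subalgebra_axioms_def by blast
qed

text \<open>A list spanning \<open>M\<close> over \<open>E\<close> still spans it over
  \<open>F\<close>, since its \<open>F\<close>-span is also an \<open>E\<close>-subspace.\<close>

lemma finite_dimension_upper:
  assumes "intermediate E" "intermediate F" "intermediate M" "E \<subseteq> F" "F \<subseteq> M" "finite_dimension E M"
  shows "finite_dimension F M"
proof -
  obtain n where "dimension n E M" using assms(6) by auto
  then obtain Us where Us: "set Us \<subseteq> carrier \<Omega>" "Span E Us = M"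
    using exists_base[OF intermediateD(1)[OF assms(1)]] by blast
  have "set Us \<subseteq> M" using Span_base_incl[OF intermediateD(1)[OF assms(1)] Us(1)] Us(2) by blast
  have "subalgebra F M \<Omega>"
    using subringE(6)[OF intermediateD(2)[OF assms(3)]] assms(5) subring.axioms(1)[OF intermediateD(2)[OF assms(3)]]
    unfolding subalgebra_def subalgebra_axioms_def by blast
  then have "Span F Us \<subseteq> M"
    using subalgebra_Span_incl[OF intermediateD(1)[OF assms(2)]] \<open>set Us \<subseteq> M\<close> by blast
  moreover have "subalgebra E (Span F Us) \<Omega>"
    using Span_is_subalgebra[OF intermediateD(1)[OF assms(2)] Us(1)] assms(4)
    unfolding subalgebra_def subalgebra_axioms_def by blast
  then have "M \<subseteq> Span F Us"
    using subalgebra_Span_incl[OF intermediateD(1)[OF assms(1)]] Us(2)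
      Span_base_incl[OF intermediateD(1)[OF assms(2)] Us(1)] by metis
  ultimately show ?thesis
    using Span_finite_dimension[OF intermediateD(1)[OF assms(2)] Us(1)] by simp
qed

lemma dim_eq_1_imp_eq:
  assumes "intermediate E" "intermediate F" "E \<subseteq> F" "finite_dimension E F" "dim E F = 1"
  shows "F = E"
proof -
  have E: "subfield E \<Omega>" using intermediateD(1)[OF assms(1)] .
  have "dimension 1 E F" using finite_dimensionE[OF E assms(4)] assms(5) unfolding over_def by simp
  moreover have "independent E [\<one>]"
    using li_Cons[of \<one> E "[]"] by auto
  ultimately have "Span E [\<one>] = F"
    using independent_length_eq_dimension[OF E, of 1 F "[\<one>]"] subringE(3)[OF intermediateD(2)[OF assms(2)]]
    by simp
  moreover have "Span E [\<one>] = E"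
    using independent_length_eq_dimension[OF E dimension_one[OF E] \<open>independent E [\<one>]\<close>]
      subringE(3)[OF intermediateD(2)[OF assms(1)]] by simp
  ultimately show ?thesis by simp
qed

text \<open>For inseparable z the fields Z = K(z^p) and Z' = K(z) are fixed by the same
  endomorphisms, so linear disjointness makes K(xs) have equal degree over both. Then [Z':Z] = 1,
  against the drop of degree from z to z^p.\<close>

lemma separable_finite_extension:
  assumes xs: "set xs \<subseteq> carrier \<Omega>" "\<And>x. x \<in> set xs \<Longrightarrow> separable_elem \<Omega> K x"
    and z: "z \<in> finite_extension K xs"
  shows "separable_elem \<Omega> K z"
proof (rule ccontr)
  let ?E = "finite_extension K xs"
  note K = intermediate_ground
  note E = intermediate_finite_extension[OF K xs(1)]
  have zc: "z \<in> carrier \<Omega>" using z intermediateD(3)[OF E(1)] by blast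
  assume "\<not> separable_elem \<Omega> K z"
  with inseparable_imp_degree_Irr_pow_less[OF subfield_axioms zc intermediate_algebraic[OF K zc]]
  obtain p :: nat where p: "prime p" "add_pow \<Omega> p \<one> = \<zero>" "degree (Irr K (z [^] p)) < degree (Irr K z)"
    by metis
  define Z where "Z = simple_extension K (z [^] p)"
  define Z' where "Z' = simple_extension K z"
  have zp: "z [^] p \<in> carrier \<Omega>" using zc by simp
  note Z = intermediate_simple_extension[OF K zp, folded Z_def]
  note Z' = intermediate_simple_extension[OF K zc, folded Z'_def]
  have ZE: "Z' \<subseteq> ?E"
    using simple_extension_subring_incl[OF intermediateD(2)[OF E(1)] E(2) z] unfolding Z'_def .
  have "z [^] n \<in> Z'" for n :: nat
    using Z'(3) subringE(3,6)[OF intermediateD(2)[OF Z'(1)]] by (induct n) auto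
  then have ZZ: "Z \<subseteq> Z'"
    using simple_extension_subring_incl[OF intermediateD(2)[OF Z'(1)] Z'(2)] unfolding Z_def by blast
  have "\<tau> x = x" if t: "\<tau> \<in> endos Z" and x: "x \<in> Z'" for \<tau> x
  proof -
    have tK: "\<tau> \<in> endos K" using endos_mono[OF Z(2)] t by blast
    let ?F = "{x \<in> carrier \<Omega>. \<forall>\<rho>\<in>{\<tau>}. \<rho> x = x}"
    have "\<tau> z = z" using endos_fixes_pow_imp_fixes[OF t p(1,2) zc endosD(2)[OF t Z(3)]] .
    moreover have "intermediate ?F" using intermediate_fixed[of "{\<tau>}"] tK by blast
    ultimately have "Z' \<subseteq> ?F"
      using simple_extension_subring_incl[of ?F K z] intermediateD[of ?F] zc unfolding Z'_def by simp
    then show ?thesis using x by blast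
  qed
  then have "dim Z' (finite_extension Z' xs) = dim Z (finite_extension Z xs)"
    using separable_elem_mono[OF K Z(1,2)] xs
    by (intro dim_finite_extension_separable[OF Z(1) Z'(1) ZZ]) auto
  \<comment> \<open>Both Z and Z' lie between \<open>K\<close> and K(xs), so adjoining
    \<open>xs\<close> to either gives K(xs) again.\<close>
  moreover have "finite_extension Z' xs = ?E" "finite_extension Z xs = ?E"
    using finite_extension_le[OF E(1) ZE E(3)] finite_extension_le[OF E(1) subset_trans[OF ZZ ZE] E(3)]
      mono_finite_extension[OF Z(2), of xs] mono_finite_extension[OF Z'(2), of xs] by blast+
  ultimately have eq: "dim Z' ?E = dim Z ?E" by simp
  note dK = dim_simple_extension[OF K zp, folded Z_def] dim_simple_extension[OF K zc, folded Z'_def]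
  have ZZ': "finite_dimension Z Z'" using finite_dimension_upper[OF K Z(1) Z'(1) Z(2) ZZ dK(4)] .
  have Z'E: "finite_dimension Z' ?E" using finite_dimension_upper[OF K Z'(1) E(1) Z'(2) ZE E(4)] .
  have "dim Z' ?E = dim Z Z' * dim Z' ?E" using eq dim_mult(2)[OF Z(1) Z'(1) ZZ' Z'E] by simp
  moreover have "dim Z' ?E > 0"
    using dim_pos[OF Z'(1) Z'E] subringE(3)[OF intermediateD(2)[OF E(1)]] .
  ultimately have "dim Z Z' = 1" by simp
  then have "dim K Z' = dim K Z" using dim_mult(2)[OF K Z(1) dK(2) ZZ'] by simp
  then show False using dK p(3) by simp
qed

lemma intermediate_separable: "intermediate {x \<in> carrier \<Omega>. separable_elem \<Omega> K x}"
  (is "intermediate ?S")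
proof (intro intermediateI subringI)
  note K = intermediate_ground
  have adj: "intermediate (finite_extension K xs)" "K \<subseteq> finite_extension K xs"
    "set xs \<subseteq> finite_extension K xs" "finite_extension K xs \<subseteq> ?S" if "set xs \<subseteq> ?S" for xs
  proof -
    have xs: "set xs \<subseteq> carrier \<Omega>" using that by blast
    note E = intermediate_finite_extension[OF K xs]
    show "intermediate (finite_extension K xs)" "K \<subseteq> finite_extension K xs"
      "set xs \<subseteq> finite_extension K xs" using E(1-3) .
    show "finite_extension K xs \<subseteq> ?S"
      using separable_finite_extension[OF xs] that intermediateD(3)[OF E(1)] by blast
  qed
  show "?S \<subseteq> carrier \<Omega>" by blast
  \<comment> \<open>The empty list of generators gives \<open>K\<close> itself.\<close>
  show KS: "K \<subseteq> ?S" using adj(2,4)[of "[]"] by simp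
  show "\<one> \<in> ?S" using KS subringE(3)[OF intermediateD(2)[OF K]] by blast
  fix x assume x: "x \<in> ?S"
  have "set [x] \<subseteq> ?S" using x by simp
  note E = adj[OF this]
  show "\<ominus> x \<in> ?S"
    using subringE(5)[OF intermediateD(2)[OF E(1)], of x] E(3,4) by fastforce
  fix y assume y: "y \<in> ?S"
  have "set [x, y] \<subseteq> ?S" using x y by simp
  note E = adj[OF this]
  have xy: "x \<in> finite_extension K [x, y]" "y \<in> finite_extension K [x, y]"
    using E(3) unfolding list.set by blast+
  show "x \<otimes> y \<in> ?S" "x \<oplus> y \<in> ?S"
    using subringE(6,7)[OF intermediateD(2)[OF E(1)] xy] E(4) by blast+
qed

lemma max_separable_eq:
  assumes "intermediate L"
  shows "max_separable \<Omega> K L = {x \<in> L. separable_elem \<Omega> K x}"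
    and "intermediate (max_separable \<Omega> K L)"
proof -
  let ?S = "{x \<in> L. separable_elem \<Omega> K x}"
  have "?S = L \<inter> {x \<in> carrier \<Omega>. separable_elem \<Omega> K x}" using intermediateD(3)[OF assms] by auto
  then have S: "intermediate ?S"
    using intermediate_Int[OF assms intermediate_separable] by simp
  show eq: "max_separable \<Omega> K L = ?S"
    unfolding max_separable_def
  proof (rule Greatest_equality)
    show "subextension \<Omega> K L ?S \<and> separable_ext \<Omega> K ?S"
      using intermediateD[OF S] unfolding subextension_def separable_ext_def by auto
    fix E assume "subextension \<Omega> K L E \<and> separable_ext \<Omega> K E"
    then show "E \<le> ?S" unfolding subextension_def separable_ext_def by blast
  qed
  show "intermediate (max_separable \<Omega> K L)" using S eq by simp
qed

subsection \<open>Normal and Galois extensions\<close>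

text \<open>Divisibility by powers of X - x does not depend on the field of coefficients, so the
  roots in the ring \<open>L\<close> are those in \<Omega> restricted to \<open>L\<close>, with the
  same multiplicities. As \<Omega> accounts for the full degree, splitting means that none is
  filtered out.\<close>

lemma splitted_subfield_iff:
  assumes "subfield L \<Omega>" "p \<in> carrier (L[X])"
  shows "ring.splitted (\<Omega>\<lparr>carrier := L\<rparr>) p \<longleftrightarrow> (\<forall>y. is_root p y \<longrightarrow> y \<in> L)"
proof -
  note L = subfieldE(1)[OF assms(1)]
  interpret F: field "\<Omega>\<lparr>carrier := L\<rparr>" using subfield_iff(2)[OF assms(1)] .
  have p: "p \<in> carrier (poly_ring \<Omega>)" using carrier_polynomial_shell[OF L assms(2)] .
  have pF: "p \<in> carrier (poly_ring (\<Omega>\<lparr>carrier := L\<rparr>))"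
    using assms(2) by (simp add: univ_poly_consistent[OF L])
  have minus: "\<ominus>\<^bsub>\<Omega>\<lparr>carrier := L\<rparr>\<^esub> x = \<ominus> x" if "x \<in> L" for x
    using F.minus_equality[of "\<ominus> x" x] that subringE(1,5)[OF L] by (auto simp: l_neg)
  have pow: "q [^]\<^bsub>L[X]\<^esub> (n::nat) = q [^]\<^bsub>poly_ring \<Omega>\<^esub> n" for q n
    unfolding nat_pow_def univ_poly_mult univ_poly_one ..
  interpret UP: domain "L[X]" using univ_poly_is_domain[OF L] .
  have am: "F.alg_mult p x = alg_mult p x" if x: "x \<in> L" for x
  proof -
    have l: "[\<one>, \<ominus> x] \<in> carrier (L[X])"
      using x subringE(1,3,5)[OF L] unfolding univ_poly_carrier[symmetric] polynomial_def by auto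
    have "[\<one>, \<ominus> x] [^]\<^bsub>L[X]\<^esub> n divides\<^bsub>L[X]\<^esub> p \<longleftrightarrow> [\<one>, \<ominus> x] [^]\<^bsub>poly_ring \<Omega>\<^esub> n pdivides p" for n :: nat
      using pdivides_iff_shell[OF assms(1) UP.nat_pow_closed[OF l] assms(2)] unfolding pow by simp
    then show ?thesis
      using x subringE(1)[OF L] minus[OF x]
      unfolding F.alg_mult_def alg_mult_def pdivides_def[of "\<Omega>\<lparr>carrier := L\<rparr>"]
      by (auto simp: univ_poly_consistent[OF L])
  qed
  have "F.roots p = filter_mset (\<lambda>y. y \<in> L) (roots p)"
  proof (rule multiset_eqI)
    fix y
    have "y \<in> L \<or> F.alg_mult p y = 0" unfolding F.alg_mult_def by simp
    then show "count (F.roots p) y = count (filter_mset (\<lambda>y. y \<in> L) (roots p)) y"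
      using am[of y] F.alg_mult_eq_count_roots[OF pF] alg_mult_eq_count_roots[OF p] by auto
  qed
  moreover have "size (roots p) = degree p" using roots_over_carrier[OF p] unfolding splitted_def .
  moreover have "size (filter_mset (\<lambda>y. y \<in> L) (roots p)) = size (roots p) \<longleftrightarrow>
      filter_mset (\<lambda>y. y \<in> L) (roots p) = roots p"
    using mset_subset_size[of "filter_mset (\<lambda>y. y \<in> L) (roots p)" "roots p"]
    by (metis multiset_filter_subset nat_less_le subset_mset.le_imp_less_or_eq)
  moreover have "filter_mset (\<lambda>y. y \<in> L) (roots p) = roots p \<longleftrightarrow> (\<forall>y\<in>#roots p. y \<in> L)"
    by (metis filter_mset_eq_conv filter_mset_True filter_mset_cong mem_Collect_eq set_mset_filter)
  ultimately show ?thesis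
    unfolding F.splitted_def using roots_mem_iff_is_root[OF p] by auto
qed

text \<open>An irreducible polynomial with root x in \<open>L\<close> is a constant times the
  minimal polynomial of x, so its roots form the orbit of x.\<close>

lemma normal_ext_iff:
  assumes "intermediate E" "intermediate L" "E \<subseteq> L"
  shows "normal_ext \<Omega> E L \<longleftrightarrow> (\<forall>\<tau>\<in>endos E. \<forall>x\<in>L. \<tau> x \<in> L)"
proof -
  have L: "subfield L \<Omega>" using intermediateD(1)[OF assms(2)] .
  have EL: "p \<in> carrier (L[X])" if "p \<in> carrier (E[X])" for p
    using that assms(3) unfolding univ_poly_carrier[symmetric] polynomial_def by auto
  have roots: "is_root p y \<longleftrightarrow> y \<in> (\<lambda>\<tau>. \<tau> x) ` endos E"
    if p: "p \<in> carrier (E[X])" "pirreducible E p" and x: "x \<in> L" "eval p x = \<zero>" for p x y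
  proof -
    have xc: "x \<in> carrier \<Omega>" using x(1) intermediateD(3)[OF assms(2)] by blast
    note E = intermediateD(1,2)[OF assms(1)] and Irr = Irr_intermediate[OF assms(1) xc]
    have "Irr E x divides\<^bsub>E[X]\<^esub> p"
      using Irr_intermediate_minimal[OF assms(1) xc p(1) x(2)] pdivides_iff_shell[OF E(1) Irr(1) p(1)] by simp
    then obtain q where q: "q \<in> carrier (E[X])" "p = Irr E x \<otimes>\<^bsub>E[X]\<^esub> q" unfolding factor_def by blast
    have "q \<in> Units (E[X])"
      using pirreducibleE(3)[OF E(2) p Irr(1) q] pirreducibleE(2)[OF E(2) Irr(1,2)] by blast
    then obtain k where k: "k \<in> E" "k \<noteq> \<zero>" "q = [k]" using univ_poly_units[OF E(1)] by blast
    have kc: "k \<in> carrier \<Omega>" using k(1) intermediateD(3)[OF assms(1)] by blast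
    have "eval p y = \<zero> \<longleftrightarrow> eval (Irr E x) y = \<zero>" if y: "y \<in> carrier \<Omega>"
    proof -
      note e = eval_is_hom[OF E(2) y]
      have "eval p y = eval (Irr E x) y \<otimes> k"
        using ring_hom_mult[OF e Irr(1) q(1)] q(2) k(3) kc y by simp
      then show ?thesis using integral_iff[OF ring_hom_closed[OF e Irr(1)] kc] k(2) by simp
    qed
    then have "is_root p y \<longleftrightarrow> is_root (Irr E x) y"
      using pirreducibleE(1)[OF E(2) p] Irr(5) unfolding is_root_def by blast
    then show ?thesis using conjugates_eq_orbit[OF assms(1) xc] by blast
  qed
  show ?thesis
  proof
    assume N: "normal_ext \<Omega> E L"
    show "\<forall>\<tau>\<in>endos E. \<forall>x\<in>L. \<tau> x \<in> L"
    proof (intro ballI)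
      fix \<tau> x assume t: "\<tau> \<in> endos E" and x: "x \<in> L"
      then have xc: "x \<in> carrier \<Omega>" using intermediateD(3)[OF assms(2)] by blast
      note Irr = Irr_intermediate[OF assms(1) xc]
      have "ring.splitted (\<Omega>\<lparr>carrier := L\<rparr>) (Irr E x)"
        using N Irr(1,2,4) x unfolding normal_ext_def by blast
      then show "\<tau> x \<in> L"
        using splitted_subfield_iff[OF L EL[OF Irr(1)]] roots[OF Irr(1,2) x Irr(4)] t by blast
    qed
  next
    assume S: "\<forall>\<tau>\<in>endos E. \<forall>x\<in>L. \<tau> x \<in> L"
    have "algebraic_ext \<Omega> E L"
      using intermediate_algebraic[OF assms(1)] intermediateD(3)[OF assms(2)]
      unfolding algebraic_ext_def by blast
    moreover have "ring.splitted (\<Omega>\<lparr>carrier := L\<rparr>) p"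
      if p: "p \<in> carrier (E[X])" "pirreducible E p" "x \<in> L" "eval p x = \<zero>" for p x
      unfolding splitted_subfield_iff[OF L EL[OF p(1)]]
    proof (intro allI impI)
      fix y assume "is_root p y"
      then obtain \<tau> where "\<tau> \<in> endos E" "y = \<tau> x" using roots[OF p] by (auto simp: image_iff)
      then show "y \<in> L" using S p(3) by simp
    qed
    ultimately show "normal_ext \<Omega> E L" unfolding normal_ext_def by blast
  qed
qed

lemma endos_separable:
  assumes "\<tau> \<in> endos K" "x \<in> carrier \<Omega>" "separable_elem \<Omega> K x"
  shows "separable_elem \<Omega> K (\<tau> x)"
proof -
  note K = intermediate_ground and Irr = Irr_intermediate[OF intermediate_ground assms(2)]
  have tx: "\<tau> x \<in> carrier \<Omega>" using endosD(3)[OF assms(1,2)] .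
  show ?thesis
    using Irr_eqI[OF subfield_axioms tx Irr(1,2) endos_root[OF K assms(1) Irr(1) assms(2) Irr(4)] Irr(3)]
      assms(3) unfolding separable_elem_def by simp
qed

text \<open>The candidate consists of the separable elements whose conjugates all stay in
  \<open>L\<close>. It is an intersection of three fields, and it is normal over \<open>K\<close>
  because \<open>endos K\<close> is closed under composition.\<close>

lemma max_galois_eq:
  assumes "intermediate L"
  shows "max_galois \<Omega> K L = {x \<in> L. separable_elem \<Omega> K x \<and> (\<forall>\<tau>\<in>endos K. \<tau> x \<in> L)}"
    and "intermediate (max_galois \<Omega> K L)"
proof -
  note K = intermediate_ground
  let ?F = "{x \<in> L. separable_elem \<Omega> K x \<and> (\<forall>\<tau>\<in>endos K. \<tau> x \<in> L)}"
  have "?F = L \<inter> ({x \<in> carrier \<Omega>. separable_elem \<Omega> K x} \<inter> {x \<in> carrier \<Omega>. \<forall>\<tau>\<in>endos K. \<tau> x \<in> L})"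
    using intermediateD(3)[OF assms] by auto
  then have F: "intermediate ?F"
    using intermediate_Int[OF assms intermediate_Int[OF intermediate_separable intermediate_stable[OF assms]]]
    by simp
  have "\<tau> x \<in> ?F" if t: "\<tau> \<in> endos K" and x: "x \<in> ?F" for \<tau> x
  proof -
    have "\<rho> (\<tau> x) \<in> L" if "\<rho> \<in> endos K" for \<rho>
    proof -
      have "(\<rho> \<circ> \<tau>) x \<in> L" using endos_comp[OF that t] x by blast
      then show ?thesis by simp
    qed
    then show ?thesis using endos_separable[OF t] t x intermediateD(3)[OF assms] by blast
  qed
  then have "normal_ext \<Omega> K ?F" using normal_ext_iff[OF K F intermediateD(4)[OF F]] by blast
  then have gal: "galois_ext \<Omega> K ?F" unfolding galois_ext_def separable_ext_def by simp
  show eq: "max_galois \<Omega> K L = ?F"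
    unfolding max_galois_def
  proof (rule Greatest_equality)
    show "subextension \<Omega> K L ?F \<and> galois_ext \<Omega> K ?F"
      using gal intermediateD[OF F] unfolding subextension_def by auto
    fix E assume E: "subextension \<Omega> K L E \<and> galois_ext \<Omega> K E"
    then have "intermediate E" unfolding subextension_def intermediate_def by blast
    then show "E \<le> ?F"
      using E normal_ext_iff[OF K, of E] intermediateD(4)
      unfolding subextension_def galois_ext_def separable_ext_def by blast
  qed
  show "intermediate (max_galois \<Omega> K L)" using F eq by simp
qed

subsection \<open>Polynomials with prescribed simple roots\<close>

text \<open>Formed once over \<Omega>, as a product over a set; the fields containing its
  coefficients are determined afterwards.\<close>

definition root_product :: "'a set \<Rightarrow> 'a list" where
  "root_product S = (\<Otimes>\<^bsub>poly_ring \<Omega>\<^esub>a\<in>S. [\<one>, \<ominus> a])"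

lemma linear_factor_closed:
  assumes "subring L \<Omega>" "a \<in> L" shows "[\<one>, \<ominus> a] \<in> carrier (L[X])"
  using assms subringE(3,5)[OF assms(1)] unfolding univ_poly_carrier[symmetric] polynomial_def by auto

lemma root_product_empty: "root_product {} = [\<one>]"
proof -
  interpret UP: domain "poly_ring \<Omega>" using univ_poly_is_domain[OF carrier_is_subring] .
  show ?thesis unfolding root_product_def by (simp add: univ_poly_one)
qed

lemma root_product_insert:
  assumes "finite S" "insert a S \<subseteq> carrier \<Omega>" "a \<notin> S"
  shows "root_product (insert a S) = [\<one>, \<ominus> a] \<otimes>\<^bsub>poly_ring \<Omega>\<^esub> root_product S"
proof -
  interpret UP: domain "poly_ring \<Omega>" using univ_poly_is_domain[OF carrier_is_subring] .
  show ?thesis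
    unfolding root_product_def using assms linear_factor_closed[OF carrier_is_subring]
    by (intro UP.finprod_insert) auto
qed

lemma root_product:
  assumes "finite S" "S \<subseteq> L" "subfield L \<Omega>"
  shows "root_product S \<in> carrier (L[X])" "root_product S \<noteq> []" "roots (root_product S) = mset_set S"
proof -
  note L = subfieldE(1,3)[OF assms(3)]
  interpret UP: domain "poly_ring \<Omega>" using univ_poly_is_domain[OF carrier_is_subring] .
  interpret UPL: domain "L[X]" using univ_poly_is_domain[OF L(1)] .
  have "root_product S \<in> carrier (L[X]) \<and> root_product S \<noteq> [] \<and> roots (root_product S) = mset_set S"
    using assms(1,2)
  proof (induct S)
    case empty
    note root_product_empty
    moreover have "[\<one>] \<in> carrier (L[X])" using UPL.one_closed unfolding univ_poly_one .
    ultimately show ?case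
      using degree_zero_imp_empty_roots[OF carrier_polynomial_shell[OF L(1)]] by auto
  next
    case (insert a S)
    have a: "a \<in> L" "a \<in> carrier \<Omega>" and S: "S \<subseteq> L" using insert(4) L(2) by auto
    note IH = insert(3)[OF S]
    note la = linear_factor_closed[OF L(1) a(1)]
    have P: "root_product S \<in> carrier (poly_ring \<Omega>)" using carrier_polynomial_shell[OF L(1)] IH by blast
    have eq: "root_product (insert a S) = [\<one>, \<ominus> a] \<otimes>\<^bsub>poly_ring \<Omega>\<^esub> root_product S"
      using root_product_insert insert(1,2,4) L(2) by blast
    have "root_product (insert a S) \<in> carrier (L[X])"
      using UPL.m_closed[OF la] IH unfolding eq univ_poly_mult by blast
    moreover have "root_product (insert a S) \<noteq> []"
      using UP.integral_iff[OF linear_factor_closed[OF carrier_is_subring a(2)] P] IH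
      unfolding eq by (simp add: univ_poly_zero)
    moreover have "roots (root_product (insert a S)) = mset_set (insert a S)"
      using poly_mult_degree_one_monic_imp_same_roots[OF a(2) P] IH insert(1,2) unfolding eq by simp
    ultimately show ?case by blast
  qed
  then show "root_product S \<in> carrier (L[X])" "root_product S \<noteq> []"
    "roots (root_product S) = mset_set S" by blast+
qed

lemma map_root_product:
  assumes "finite S" "S \<subseteq> L" "subfield L \<Omega>" "h \<in> ring_hom (\<Omega>\<lparr>carrier := L\<rparr>) (\<Omega>\<lparr>carrier := L\<rparr>)" "inj_on h S"
  shows "map h (root_product S) = root_product (h ` S)"
  using assms(1,2,5)
proof (induct S)
  note L = subfieldE(1,3)[OF assms(3)]
  interpret F: field "\<Omega>\<lparr>carrier := L\<rparr>" using subfield_iff(2)[OF assms(3)] .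
  interpret h: ring_hom_ring "\<Omega>\<lparr>carrier := L\<rparr>" "\<Omega>\<lparr>carrier := L\<rparr>" h
    using ring_hom_ringI2[OF F.ring_axioms F.ring_axioms assms(4)] .
  case empty
  show ?case using h.hom_one by (simp add: root_product_empty)
next
  note L = subfieldE(1,3)[OF assms(3)]
  interpret F: field "\<Omega>\<lparr>carrier := L\<rparr>" using subfield_iff(2)[OF assms(3)] .
  interpret h: ring_hom_ring "\<Omega>\<lparr>carrier := L\<rparr>" "\<Omega>\<lparr>carrier := L\<rparr>" h
    using ring_hom_ringI2[OF F.ring_axioms F.ring_axioms assms(4)] .
  case (insert a S)
  have a: "a \<in> L" "h a \<in> L" and S: "S \<subseteq> L" "h ` S \<subseteq> L" using insert(4) h.hom_closed by auto
  have minus: "\<ominus>\<^bsub>\<Omega>\<lparr>carrier := L\<rparr>\<^esub> x = \<ominus> x" if "x \<in> L" for x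
    using F.minus_equality[of "\<ominus> x" x] that L(2) subringE(5)[OF L(1)] by (auto simp: l_neg)
  have hl: "map h [\<one>, \<ominus> a] = [\<one>, \<ominus> h a]"
    using h.hom_one h.hom_a_inv[of a] a minus by simp
  have ins: "root_product (insert b T) = poly_mult [\<one>, \<ominus> b] (root_product T)"
    if "finite T" "insert b T \<subseteq> L" "b \<notin> T" for b T
    using root_product_insert[of T b] that L(2) unfolding univ_poly_mult by blast
  have P: "root_product T \<in> carrier (L[X])" if "finite T" "T \<subseteq> L" for T using root_product(1) that assms(3) .
  \<comment> \<open>Compatibility of \<open>h\<close> with multiplication is stated up to
    \<open>normalize\<close>, which changes nothing on a genuine polynomial.\<close>
  have "map h (root_product (insert a S)) = normalize (map h (root_product (insert a S)))"
  proof -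
    have "map h (root_product (insert a S)) \<in> carrier (L[X])"
      using polynomial_hom[OF assms(4) F.field_axioms F.field_axioms] P[of "insert a S"] insert(1,4)
      by (simp add: univ_poly_consistent[OF L(1)])
    then show ?thesis using normalize_polynomial unfolding univ_poly_carrier[symmetric] by metis
  qed
  also have "\<dots> = normalize (map h (poly_mult [\<one>, \<ominus> a] (root_product S)))"
    using ins insert(1,2,4) by metis
  also have "\<dots> = poly_mult (map h [\<one>, \<ominus> a]) (map h (root_product S))"
    using h.poly_mult_hom'[of "[\<one>, \<ominus> a]" "root_product S"] a(1) subringE(3,5)[OF L(1)]
      set_poly_subset[OF P[OF insert(1) S(1)]]
    unfolding poly_mult_consistent[OF L(1)] normalize_consistent[OF L(1)] by simp
  also have "\<dots> = poly_mult [\<one>, \<ominus> h a] (root_product (h ` S))"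
    using insert(3,5) S(1) hl by (metis inj_on_insert)
  also have "\<dots> = root_product (insert (h a) (h ` S))"
    using ins[of "h ` S" "h a"] insert(1,2,5) a(2) S(2) by auto
  finally show ?case by simp
qed

end

subsection \<open>Characterisations of normality\<close>

locale finite_field_extension = field_closure +
  fixes L
  assumes L: "intermediate L" and finite_dim: "finite_dimension K L"
begin

abbreviation "L\<^sub>S \<equiv> max_separable \<Omega> K L"
abbreviation "L\<^sub>I \<equiv> max_purely_insep \<Omega> K L"
abbreviation "F \<equiv> max_galois \<Omega> K L"
abbreviation "A \<equiv> Aut_ext \<Omega> K L"
abbreviation "conj_stable \<equiv> \<forall>\<tau>\<in>endos K. \<forall>x\<in>L. \<tau> x \<in> L"

lemmas K = intermediate_ground
lemmas LS = max_separable_eq[OF L] and LI = max_purely_insep_eq[OF L] and F = max_galois_eq[OF L]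

lemma L_carrier: "x \<in> L \<Longrightarrow> x \<in> carrier \<Omega>"
  using intermediateD(3)[OF L] by blast

lemma normal_iff_stable: "normal_ext \<Omega> K L \<longleftrightarrow> conj_stable"
  using normal_ext_iff[OF K L intermediateD(4)[OF L]] .

text \<open>This is what makes normality over \<open>K\<close> and over \<open>L\<^sub>I\<close> the
  same condition.\<close>

lemma endos_LI: "endos L\<^sub>I = endos K"
proof
  show "endos L\<^sub>I \<subseteq> endos K" using endos_mono[OF intermediateD(4)[OF LI(2)]] .
  show "endos K \<subseteq> endos L\<^sub>I" unfolding LI(1) endos_def by auto
qed

lemma normal_over_LI_iff: "normal_ext \<Omega> L\<^sub>I L \<longleftrightarrow> conj_stable"
  using normal_ext_iff[OF LI(2) L] endos_LI unfolding LI(1) by auto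

lemma stable_iff_subset: "conj_stable \<longleftrightarrow> L \<subseteq> {x \<in> carrier \<Omega>. \<forall>\<tau>\<in>endos K. \<tau> x \<in> L}"
  using L_carrier by auto

section \<open>Automorphisms of \<open>L\<close> and their fixed field\<close>

lemma Aut_extD:
  assumes "\<tau> \<in> A"
  shows "\<tau> \<in> ring_hom (\<Omega>\<lparr>carrier := L\<rparr>) (\<Omega>\<lparr>carrier := L\<rparr>)" "bij_betw \<tau> L L"
    "\<And>x. x \<in> K \<Longrightarrow> \<tau> x = x"
  using assms unfolding Aut_ext_def ring_iso_def by auto

text \<open>An element of \<open>A\<close> is defined on \<open>L\<close> alone and is not a member
  of \<open>endos K\<close>, so the argument on roots is carried out inside the ring
  \<open>L\<close>.\<close>

lemma Aut_conjugates:
  assumes "\<tau> \<in> A" "x \<in> L" shows "\<tau> x \<in> conjugates K x" "\<tau> x \<in> L"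
proof -
  note Ls = intermediateD(2)[OF L]
  interpret R: ring "\<Omega>\<lparr>carrier := L\<rparr>" using subring_is_ring[OF Ls] .
  interpret t: ring_hom_ring "\<Omega>\<lparr>carrier := L\<rparr>" "\<Omega>\<lparr>carrier := L\<rparr>" \<tau>
    using ring_hom_ringI2[OF R.ring_axioms R.ring_axioms Aut_extD(1)[OF assms(1)]] .
  note Irr = Irr_intermediate[OF K L_carrier[OF assms(2)]]
  have set: "set (Irr K x) \<subseteq> K" using set_poly_subset[OF Irr(1)] .
  show tx: "\<tau> x \<in> L" using t.hom_closed assms(2) by simp
  have "map \<tau> (Irr K x) = Irr K x" using set Aut_extD(3)[OF assms(1)] by (intro map_idI) auto
  moreover have "set (Irr K x) \<subseteq> L" using set intermediateD(4)[OF L] by blast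
  moreover have "\<tau> \<zero> = \<zero>" using t.hom_zero by simp
  ultimately have "eval (Irr K x) (\<tau> x) = \<zero>"
    using t.eval_hom'[of x "Irr K x"] assms(2) Irr(4) unfolding eval_consistent[OF Ls] by simp
  then show "\<tau> x \<in> conjugates K x" using L_carrier[OF tx] Irr(5) unfolding is_root_def by simp
qed

lemma finite_conjugates: "x \<in> L \<Longrightarrow> finite (conjugates K x)"
  using finite_number_of_roots[OF Irr_intermediate(6)[OF K L_carrier]] .

lemma LI_subset_fixed_field: "L\<^sub>I \<subseteq> fixed_field L A"
proof
  fix x assume x: "x \<in> L\<^sub>I"
  then have xL: "x \<in> L" and fixed: "\<And>\<tau>. \<tau> \<in> endos K \<Longrightarrow> \<tau> x = x" unfolding LI(1) by auto
  then have "conjugates K x \<subseteq> {x}" unfolding conjugates_eq_orbit[OF K L_carrier[OF xL]] by auto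
  then show "x \<in> fixed_field L A" using Aut_conjugates(1) xL unfolding fixed_field_def by blast
qed

text \<open>Surjectivity is the point: \<tau> maps the finite set of conjugates of y injectively
  into itself, hence onto, and stability places that set inside \<open>L\<close>.\<close>

lemma restrict_in_Aut_ext:
  assumes "conj_stable" "\<tau> \<in> endos K" shows "restrict \<tau> L \<in> A"
proof -
  interpret t: ring_hom_ring \<Omega> \<Omega> \<tau> using endosD(4)[OF assms(2)] .
  note Ls = subringE[OF intermediateD(2)[OF L]]
  have img: "\<tau> ` L \<subseteq> L" using assms by blast
  have "L \<subseteq> \<tau> ` L"
  proof
    fix y assume y: "y \<in> L"
    let ?C = "conjugates K y"
    note C = conjugates_eq_orbit[OF K L_carrier[OF y]]
    have CL: "?C \<subseteq> L" unfolding C using assms(1) y by auto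
    have "\<tau> ` ?C \<subseteq> ?C"
      using endos_root[OF K assms(2) Irr_intermediate(1)[OF K L_carrier[OF y]]] endosD(3)[OF assms(2)]
      unfolding is_root_def by auto
    moreover have "inj_on \<tau> ?C"
      using endos_inj[OF assms(2)] CL L_carrier by (meson inj_on_subset subsetI subsetD)
    ultimately have "\<tau> ` ?C = ?C" using endo_inj_surj[OF finite_conjugates[OF y]] by blast
    moreover have "y \<in> ?C"
      using Irr_intermediate(4,5)[OF K L_carrier[OF y]] L_carrier[OF y] unfolding is_root_def by simp
    ultimately show "y \<in> \<tau> ` L" using CL by blast
  qed
  with img have "\<tau> ` L = L" by blast
  moreover have "inj_on \<tau> L" using endos_inj[OF assms(2)] L_carrier by (meson inj_on_subset subsetI)
  ultimately have bij: "bij_betw (restrict \<tau> L) L L" by (simp add: bij_betw_def)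
  have "restrict \<tau> L \<in> ring_hom (\<Omega>\<lparr>carrier := L\<rparr>) (\<Omega>\<lparr>carrier := L\<rparr>)"
    by (rule ring_hom_memI) (use img Ls L_carrier in auto)
  then show ?thesis
    using bij endosD(2)[OF assms(2)] intermediateD(4)[OF L]
    unfolding Aut_ext_def ring_iso_def by auto
qed

lemma stable_imp_fixed_field_eq:
  assumes "conj_stable" shows "fixed_field L A = L\<^sub>I"
proof
  show "fixed_field L A \<subseteq> L\<^sub>I"
  proof
    fix x assume x: "x \<in> fixed_field L A"
    then have xL: "x \<in> L" unfolding fixed_field_def by simp
    have "\<tau> x = x" if "\<tau> \<in> endos K" for \<tau>
    proof -
      have "restrict \<tau> L x = x"
        using x restrict_in_Aut_ext[OF assms that] unfolding fixed_field_def by blast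
      then show ?thesis using xL by simp
    qed
    then show "x \<in> L\<^sub>I" using xL unfolding LI(1) by blast
  qed
qed (rule LI_subset_fixed_field)

lemma Aut_ext_comp:
  assumes "\<rho> \<in> A" "\<tau> \<in> A" shows "compose L \<rho> \<tau> \<in> A"
proof -
  note r = Aut_extD[OF assms(1)] and t = Aut_extD[OF assms(2)]
  have c: "x \<in> L \<Longrightarrow> \<tau> x \<in> L" for x using Aut_conjugates(2)[OF assms(2)] .
  have "bij_betw (compose L \<rho> \<tau>) L L" using bij_betw_compose[OF t(2) r(2)] .
  moreover have "compose L \<rho> \<tau> \<in> ring_hom (\<Omega>\<lparr>carrier := L\<rparr>) (\<Omega>\<lparr>carrier := L\<rparr>)"
  proof -
    have "\<rho> \<circ> \<tau> \<in> ring_hom (\<Omega>\<lparr>carrier := L\<rparr>) (\<Omega>\<lparr>carrier := L\<rparr>)" using ring_hom_trans[OF t(1) r(1)] .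
    moreover have "compose L \<rho> \<tau> z = (\<rho> \<circ> \<tau>) z" if "z \<in> L" for z using that by (simp add: compose_eq)
    ultimately show ?thesis
      using subringE(3,6,7)[OF intermediateD(2)[OF L]] unfolding ring_hom_def
      by (simp del: comp_apply add: Pi_iff)
  qed
  moreover have "compose L \<rho> \<tau> x = x" if "x \<in> K" for x
    using r(3)[OF that] t(3)[OF that] that intermediateD(4)[OF L] by (simp add: compose_eq subsetD)
  ultimately show ?thesis unfolding Aut_ext_def ring_iso_def by simp
qed

lemma restrict_id_in_Aut_ext: "(\<lambda>x\<in>L. x) \<in> A"
  using subringE(3,6,7)[OF intermediateD(2)[OF L]] intermediateD(4)[OF L]
  unfolding Aut_ext_def ring_iso_def ring_hom_def
  by (auto simp: bij_betw_def inj_on_def image_iff)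

lemma fixed_field_eq_imp_galois:
  assumes "fixed_field L A = L\<^sub>I" shows "galois_ext \<Omega> L\<^sub>I L"
proof -
  have main: "separable_elem \<Omega> L\<^sub>I x \<and> (\<forall>\<tau>\<in>endos L\<^sub>I. \<tau> x \<in> L)" if x: "x \<in> L" for x
  proof -
    \<comment> \<open>The orbit of \<open>x\<close> under \<open>A\<close>; it is finite because it
      consists of conjugates of \<open>x\<close> over \<open>K\<close>.\<close>
    define S where "S = (\<lambda>\<tau>. \<tau> x) ` A"
    let ?f = "root_product S"
    have fin: "finite S"
      using Aut_conjugates(1)[OF _ x] unfolding S_def
      by (intro finite_subset[OF _ finite_conjugates[OF x]]) blast
    have SL: "S \<subseteq> L" using Aut_conjugates(2)[OF _ x] unfolding S_def by blast
    have "(\<lambda>x\<in>L. x) x \<in> S" unfolding S_def using restrict_id_in_Aut_ext by (rule imageI)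
    then have xS: "x \<in> S" using x by simp
    note f = root_product[OF fin SL intermediateD(1)[OF L]]
    \<comment> \<open>Each automorphism permutes the orbit and so fixes the coefficients of its root
      product, which puts them into \<open>L\<^sup>A\<close>.\<close>
    have "\<tau> c = c" if t: "\<tau> \<in> A" and c: "c \<in> set ?f" for \<tau> c
    proof -
      have inj: "inj_on \<tau> S" using Aut_extD(2)[OF t] SL by (meson bij_betw_imp_inj_on inj_on_subset)
      have "\<tau> (\<rho> x) \<in> S" if "\<rho> \<in> A" for \<rho>
      proof -
        have "compose L \<tau> \<rho> x \<in> S" unfolding S_def using Aut_ext_comp[OF t that] by (rule imageI)
        then show ?thesis using x by (simp add: compose_eq)
      qed
      then have "\<tau> ` S = S" using endo_inj_surj[OF fin _ inj] unfolding S_def by blast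
      then have "map \<tau> ?f = ?f"
        using map_root_product[OF fin SL intermediateD(1)[OF L] Aut_extD(1)[OF t] inj] by simp
      then show ?thesis using c by (metis list.map_id map_eq_conv id_apply)
    qed
    then have "set ?f \<subseteq> fixed_field L A"
      using set_poly_subset[OF f(1)] unfolding fixed_field_def by blast
    then have fI: "?f \<in> carrier (L\<^sub>I[X])"
      using assms f(1) unfolding univ_poly_carrier[symmetric] polynomial_def by auto
    have fc: "?f \<in> carrier (poly_ring \<Omega>)"
      using carrier_polynomial_shell[OF intermediateD(2)[OF L] f(1)] .
    have root: "is_root ?f y \<longleftrightarrow> y \<in> S" for y
      using roots_mem_iff_is_root[OF fc] f(3) fin by simp
    then have fx: "eval ?f x = \<zero>" using xS unfolding is_root_def by blast
    have "separable_elem \<Omega> L\<^sub>I x"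
      using separable_elem_of_dvd[OF LI(2) L_carrier[OF x] fI f(2) fx] f(3)
      by (simp add: count_mset_set')
    moreover have "\<tau> x \<in> L" if "\<tau> \<in> endos L\<^sub>I" for \<tau>
    proof -
      have "eval ?f (\<tau> x) = \<zero>" using endos_root[OF LI(2) that fI L_carrier[OF x] fx] .
      then have "is_root ?f (\<tau> x)"
        using f(2) endosD(3)[OF that L_carrier[OF x]] unfolding is_root_def by simp
      then show ?thesis using root SL by blast
    qed
    ultimately show ?thesis by blast
  qed
  then show ?thesis
    using normal_over_LI_iff unfolding galois_ext_def separable_ext_def endos_LI by blast
qed

text \<open>Stability gives normality over \<open>L\<^sub>I\<close> at once. Separability takes a
  detour: stability yields \<open>L\<^sup>A = L\<^sub>I\<close>, and the orbit polynomials then have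
  simple roots and coefficients in \<open>L\<^sub>I\<close>.\<close>

lemma galois_over_LI_iff_stable: "galois_ext \<Omega> L\<^sub>I L \<longleftrightarrow> conj_stable"
  using fixed_field_eq_imp_galois stable_imp_fixed_field_eq normal_over_LI_iff
  unfolding galois_ext_def by blast

section \<open>Generation by \<open>L\<^sub>S\<close> and \<open>L\<^sub>I\<close>, and the degree
  criteria\<close>

lemma finite_dims:
  assumes "intermediate E" "intermediate M" "E \<subseteq> M" "M \<subseteq> L" shows "finite_dimension E M"
proof -
  have "finite_dimension K M"
    using finite_dimension_subset[OF K assms(2) intermediateD(4)[OF assms(2)] assms(4) finite_dim] .
  then show ?thesis
    using finite_dimension_upper[OF K assms(1,2) intermediateD(4)[OF assms(1)] assms(3)] by blast
qed

lemma F_subset_LS: "F \<subseteq> L\<^sub>S" "L\<^sub>S \<subseteq> L" "L\<^sub>I \<subseteq> L" "F \<subseteq> L"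
  unfolding F(1) LS(1) LI(1) by auto

lemma stable_imp_F_eq: "conj_stable \<Longrightarrow> F = L\<^sub>S"
  unfolding F(1) LS(1) by blast

text \<open>Elements of \<open>L\<close> are separable over \<open>M\<close> since they are so over
  \<open>L\<^sub>I\<close>, and are fixed by \<open>endos M\<close> since \<open>M\<close> contains
  all separable elements of \<open>L\<close>. Such elements lie in \<open>M\<close>.\<close>

lemma stable_imp_subset:
  assumes "conj_stable" "intermediate M" "L\<^sub>S \<subseteq> M" "L\<^sub>I \<subseteq> M" shows "L \<subseteq> M"
proof
  fix x assume x: "x \<in> L"
  have "separable_elem \<Omega> L\<^sub>I x"
    using galois_over_LI_iff_stable assms(1) x unfolding galois_ext_def separable_ext_def by blast
  then have sep: "separable_elem \<Omega> M x"
    using separable_elem_mono[OF LI(2) assms(2,4) L_carrier[OF x]] by blast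
  have "\<tau> x = x" if "\<tau> \<in> endos M" for \<tau>
    using endos_fixes_of_separable[OF L _ that x] assms(3) unfolding LS(1) by blast
  then show "x \<in> M" using separable_fixed_imp_mem[OF assms(2) L_carrier[OF x] sep] by blast
qed

text \<open>The elements whose images under \<open>endos K\<close> all lie in \<open>L\<close> form
  a field containing \<open>F\<close> and \<open>L\<^sub>I\<close>, hence containing
  \<open>M\<close>. Generation is stated as minimality so that both the compositum and a finite
  extension of \<open>L\<^sub>I\<close> fit.\<close>

lemma generated_imp_stable:
  assumes "L \<subseteq> M"
    and "\<And>E. intermediate E \<Longrightarrow> F \<subseteq> E \<Longrightarrow> L\<^sub>I \<subseteq> E \<Longrightarrow> M \<subseteq> E"
  shows "conj_stable"
proof -
  have "F \<subseteq> {x \<in> carrier \<Omega>. \<forall>\<tau>\<in>endos K. \<tau> x \<in> L}" "L\<^sub>I \<subseteq> {x \<in> carrier \<Omega>. \<forall>\<tau>\<in>endos K. \<tau> x \<in> L}"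
    using L_carrier unfolding F(1) LI(1) by auto
  then show ?thesis
    using assms intermediate_stable[OF L order_refl] unfolding stable_iff_subset by blast
qed

lemma stable_iff_u_index:
  "conj_stable \<longleftrightarrow> u_index \<Omega> K L = 1 \<and> L = compositum \<Omega> L\<^sub>S L\<^sub>I"
proof -
  define C where "C = compositum \<Omega> L\<^sub>S L\<^sub>I"
  have sub: "L\<^sub>S \<union> L\<^sub>I \<subseteq> carrier \<Omega>" using F_subset_LS L_carrier by blast
  have CS: "L\<^sub>S \<subseteq> C" "L\<^sub>I \<subseteq> C" using generate_fieldE(2)[OF sub] unfolding C_def compositum_def by auto
  then have C: "intermediate C"
    using generate_field_is_subfield[OF sub] intermediateD(4)[OF LS(2)]
    unfolding C_def compositum_def intermediate_def by blast
  have min: "C \<subseteq> E" if "intermediate E" "L\<^sub>S \<subseteq> E" "L\<^sub>I \<subseteq> E" for E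
    using generate_field_min_subfield1[OF sub intermediateD(1)[OF that(1)]] that
    unfolding C_def compositum_def by blast
  show ?thesis
    unfolding C_def[symmetric]
  proof
    assume st: "conj_stable"
    have "L = C" using stable_imp_subset[OF st C CS] min[OF L] F_subset_LS by blast
    moreover have "u_index \<Omega> K L = 1"
      using dimI[OF intermediateD(1)[OF LS(2)] dimension_one[OF intermediateD(1)[OF LS(2)]]]
      unfolding u_index_def stable_imp_F_eq[OF st] over_def .
    ultimately show "u_index \<Omega> K L = 1 \<and> L = C" by blast
  next
    \<comment> \<open>Index one means \<open>L\<^sub>S = F\<close>, so the compositum is generated
      by \<open>F\<close> and \<open>L\<^sub>I\<close>.\<close>
    assume u: "u_index \<Omega> K L = 1 \<and> L = C"
    then have "L\<^sub>S = F"
      using dim_eq_1_imp_eq[OF F(2) LS(2) F_subset_LS(1) finite_dims[OF F(2) LS(2) F_subset_LS(1,2)]]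
      unfolding u_index_def by blast
    then show "conj_stable" using generated_imp_stable[of C] min u by auto
  qed
qed

text \<open>Let \<open>M\<close> be the field generated by \<open>F\<close> and
  \<open>L\<^sub>I\<close>. Linear disjointness gives [M:L_I] = [F:K], so [L:L_I] is the ascending
  index times [L:M], and equality with the index means \<open>L = M\<close>.\<close>

lemma stable_iff_ascending_index:
  "conj_stable \<longleftrightarrow> ascending_index \<Omega> K L = dim L\<^sub>I L"
proof -
  \<comment> \<open>A basis of \<open>F\<close> over \<open>K\<close> serves as a list of field
    generators, the form in which linear disjointness is available.\<close>
  obtain n where "dimension n K F"
    using finite_dims[OF K F(2) intermediateD(4)[OF F(2)] F_subset_LS(4)] by auto
  then obtain xs where xs: "set xs \<subseteq> carrier \<Omega>" "Span K xs = F"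
    using exists_base[OF subfield_axioms] by blast
  have xF: "set xs \<subseteq> F" using Span_base_incl[OF subfield_axioms xs(1)] xs(2) by blast
  note EK = intermediate_finite_extension[OF K xs(1)]
  have "subalgebra K (finite_extension K xs) \<Omega>"
    using finite_dimension_imp_subalgebra[OF subfield_axioms EK(4)] .
  then have "F \<subseteq> finite_extension K xs"
    using subalgebra_Span_incl[OF subfield_axioms _ EK(3)] xs(2) by blast
  moreover have "finite_extension K xs \<subseteq> F"
    using finite_extension_le[OF F(2) intermediateD(4)[OF F(2)] xF] .
  ultimately have Fxs: "finite_extension K xs = F" by blast
  define M where "M = finite_extension L\<^sub>I xs"
  note M = intermediate_finite_extension[OF LI(2) xs(1), folded M_def]
  have min: "M \<subseteq> E" if "intermediate E" "F \<subseteq> E" "L\<^sub>I \<subseteq> E" for E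
    using finite_extension_le[OF that(1,3)] that(2) xF unfolding M_def by blast
  have FM: "F \<subseteq> M"
    using mono_finite_extension[OF intermediateD(4)[OF LI(2)], of xs] unfolding Fxs M_def .
  have M_le: "M \<subseteq> L" using min[OF L] F_subset_LS by blast
  have "dim L\<^sub>I M = dim K (finite_extension K xs)"
    unfolding M_def
  proof (rule dim_finite_extension_separable[OF K LI(2) intermediateD(4)[OF LI(2)] _ xs(1)])
    show "\<tau> x = x" if "\<tau> \<in> endos K" "x \<in> L\<^sub>I" for \<tau> x using that unfolding LI(1) by blast
    show "separable_elem \<Omega> K x" if "x \<in> set xs" for x using that xF unfolding F(1) by blast
  qed
  then have dimM: "dim L\<^sub>I M = ascending_index \<Omega> K L" unfolding ascending_index_def Fxs .
  note fin = finite_dims[OF LI(2) M(1,2) M_le] finite_dims[OF M(1) L M_le order_refl]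
  show ?thesis
  proof
    assume st: "conj_stable"
    then have "L \<subseteq> M" using stable_imp_subset[OF st M(1) _ M(2)] FM stable_imp_F_eq by blast
    then show "ascending_index \<Omega> K L = dim L\<^sub>I L" using M_le dimM by force
  next
    assume "ascending_index \<Omega> K L = dim L\<^sub>I L"
    then have "dim L\<^sub>I M = dim L\<^sub>I M * dim M L" using dim_mult(2)[OF LI(2) M(1) fin] dimM by simp
    moreover have "dim L\<^sub>I M > 0"
      using dim_pos[OF LI(2) fin(1)] subringE(3)[OF intermediateD(2)[OF M(1)]] .
    ultimately have "dim M L = 1" by simp
    then have "L = M" using dim_eq_1_imp_eq[OF M(1) L M_le fin(2)] by blast
    then show "conj_stable" using generated_imp_stable[of M] min by blast
  qed
qed

end

theorem corollary2p12p1: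
  fixes \<Omega> :: "('a, 'b) ring_scheme" and K L :: "'a set"
  assumes "algebraic_closure \<Omega> K"
    and "subfield L \<Omega>" and "K \<subseteq> L" and "ring.finite_dimension \<Omega> K L"
  shows "let L\<^sub>S = max_separable \<Omega> K L; L\<^sub>I = max_purely_insep \<Omega> K L; A = Aut_ext \<Omega> K L in
      (normal_ext \<Omega> K L \<longleftrightarrow> ascending_index \<Omega> K L = ring.dim \<Omega> L\<^sub>I L) \<and>
      (normal_ext \<Omega> K L \<longleftrightarrow> u_index \<Omega> K L = 1 \<and> L = compositum \<Omega> L\<^sub>S L\<^sub>I) \<and>
      (normal_ext \<Omega> K L \<longleftrightarrow> fixed_field L A = L\<^sub>I) \<and>
      (normal_ext \<Omega> K L \<longleftrightarrow> galois_ext \<Omega> L\<^sub>I L)"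
proof -
  interpret field_closure \<Omega> K using assms(1) unfolding field_closure_def .
  interpret finite_field_extension \<Omega> K L
    using assms(2-4) by unfold_locales (auto simp: intermediate_def)
  have "fixed_field L A = L\<^sub>I \<longleftrightarrow> conj_stable"
    using stable_imp_fixed_field_eq fixed_field_eq_imp_galois galois_over_LI_iff_stable by blast
  then show ?thesis
    unfolding Let_def normal_iff_stable
    using stable_iff_ascending_index stable_iff_u_index galois_over_LI_iff_stable by blast
qed

end
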